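(* There exists a $2$-dimensional, geodesically complete smooth Riemannian manifold $N$ with unbounded Gaussian curvature such that $\mathrm{CZ}(2)$ fails on $N$; that is, there are no constants $C_1\ge0$, $C_2>0$ such that $\|\mathrm{Hess}(u)\|_2\le C_1\|u\|_2+C_2\|\Delta u\|_2$ for all $u\in C^\infty_{\mathrm{c}}(N)$.
   Context: Manifolds are smooth and without boundary. $\|\cdot\|_2$ are $\mathsf{L}^2$-norms with respect to the Riemannian volume measure, of functions or of pointwise norms of tensors (induced by the metric). $\mathrm{Hess}(u)=\nabla\mathrm{d}u$ with $\nabla$ the Levi-Civita connection, and $\Delta u=-\mathrm{tr}(\mathrm{Hess}(u))$. *)

theory Defs
  imports "HOL-Analysis.Analysis"
begin

section \<open>Smooth maps between open sets of normed spaces\<close>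

text \<open>Only used for open \<open>S\<close>. For finite-dimensional domains, \<open>C_k_on k S f\<close> says that
  \<open>f\<close> is \<open>k\<close> times continuously differentiable on \<open>S\<close>.\<close>

primrec C_k_on ::
    "nat \<Rightarrow> 'a::real_normed_vector set \<Rightarrow> ('a \<Rightarrow> 'b::real_normed_vector) \<Rightarrow> bool" where
  "C_k_on 0 S f \<longleftrightarrow> continuous_on S f"
| "C_k_on (Suc k) S f \<longleftrightarrow>
     (\<forall>x\<in>S. f differentiable (at x)) \<and>
     (\<forall>v. C_k_on k S (\<lambda>x. frechet_derivative f (at x) v))"

definition smooth_on ::
    "'a::real_normed_vector set \<Rightarrow> ('a \<Rightarrow> 'b::real_normed_vector) \<Rightarrow> bool" where
  "smooth_on S f \<longleftrightarrow> (\<forall>k. C_k_on k S f)"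

definition partial_deriv ::
    "'n::finite \<Rightarrow> (real^'n \<Rightarrow> 'b::real_normed_vector) \<Rightarrow> real^'n \<Rightarrow> 'b" where
  "partial_deriv i f x = frechet_derivative f (at x) (axis i 1)"


section \<open>Smooth manifolds\<close>

text \<open>A chart is a pair of its domain \<open>U\<close> and a map \<open>\<phi>\<close>, of which only the
  values on \<open>U\<close> matter.\<close>

type_synonym ('a, 'n) chart = "'a set \<times> ('a \<Rightarrow> real^'n)"

definition chart_image :: "('a, 'n::finite) chart \<Rightarrow> (real^'n) set" where
  "chart_image c = snd c ` fst c"

definition chart_inv :: "('a, 'n::finite) chart \<Rightarrow> real^'n \<Rightarrow> 'a" where
  "chart_inv c = inv_into (fst c) (snd c)"

definition smooth_manifold :: "'a topology \<Rightarrow> ('a, 'n::finite) chart set \<Rightarrow> bool" where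
  "smooth_manifold X A \<longleftrightarrow>
     Hausdorff_space X \<and> second_countable X \<and>
     (\<Union>c\<in>A. fst c) = topspace X \<and>
     (\<forall>c\<in>A. openin X (fst c) \<and> open (chart_image c) \<and>
        homeomorphic_map (subtopology X (fst c)) (top_of_set (chart_image c)) (snd c)) \<and>
     (\<forall>c\<in>A. \<forall>d\<in>A. smooth_on (snd c ` (fst c \<inter> fst d)) (snd d \<circ> chart_inv c))"


section \<open>Riemannian manifolds\<close>

text \<open>The metric is given by its component matrices: \<open>metric N c p $ i $ j\<close> is the value of
  the metric at the point \<open>p\<close> on the coordinate vector fields \<open>\<partial>\<^sub>i, \<partial>\<^sub>j\<close> of the chart \<open>c\<close>.
  The last clause of \<open>riemannian_manifold\<close> is the transformation law of a covariant 2-tensor,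
  so that the matrices for the different charts describe one tensor field.\<close>

record ('a, 'n) riem_mfd =
  mtop :: "'a topology"
  atlas :: "('a, 'n::finite) chart set"
  metric :: "('a, 'n) chart \<Rightarrow> 'a \<Rightarrow> real^'n^'n"

definition local_metric ::
    "('a, 'n::finite) riem_mfd \<Rightarrow> ('a, 'n) chart \<Rightarrow> real^'n \<Rightarrow> real^'n^'n" where
  "local_metric N c x = metric N c (chart_inv c x)"

definition riemannian_manifold :: "('a, 'n::finite) riem_mfd \<Rightarrow> bool" where
  "riemannian_manifold N \<longleftrightarrow>
     smooth_manifold (mtop N) (atlas N) \<and>
     (\<forall>c\<in>atlas N. smooth_on (chart_image c) (local_metric N c)) \<and>
     (\<forall>c\<in>atlas N. \<forall>p\<in>fst c.
        transpose (metric N c p) = metric N c p \<and>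
        (\<forall>v. v \<noteq> 0 \<longrightarrow> v \<bullet> (metric N c p *v v) > 0)) \<and>
     (\<forall>c\<in>atlas N. \<forall>d\<in>atlas N. \<forall>p\<in>fst c \<inter> fst d.
        let J = matrix (frechet_derivative (snd d \<circ> chart_inv c) (at (snd c p)))
        in metric N c p = transpose J ** metric N d p ** J)"

text \<open>The pointwise quantities below are computed in some chart around the point; being tensorial,
  they do not depend on which one.\<close>

definition chart_at :: "('a, 'n::finite) riem_mfd \<Rightarrow> 'a \<Rightarrow> ('a, 'n) chart" where
  "chart_at N p = (SOME c. c \<in> atlas N \<and> p \<in> fst c)"

definition inv_metric ::
    "('a, 'n::finite) riem_mfd \<Rightarrow> ('a, 'n) chart \<Rightarrow> real^'n \<Rightarrow> real^'n^'n" where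
  "inv_metric N c x = matrix_inv (local_metric N c x)"


subsection \<open>The Levi-Civita connection\<close>

text \<open>\<open>christoffel N c k i j\<close> is the component \<open>\<Gamma>\<^sup>k\<^sub>i\<^sub>j\<close> of the Levi-Civita
  connection, given by \<open>\<nabla>\<^bsub>\<partial>\<^sub>i\<^esub> \<partial>\<^sub>j = (\<Sum>k. \<Gamma>\<^sup>k\<^sub>i\<^sub>j \<partial>\<^sub>k)\<close>. Lemma \<open>levi_civita_unique\<close> below
  characterises it as the torsion-free connection that is compatible with the metric.\<close>

definition christoffel ::
    "('a, 'n::finite) riem_mfd \<Rightarrow> ('a, 'n) chart \<Rightarrow> 'n \<Rightarrow> 'n \<Rightarrow> 'n \<Rightarrow> real^'n \<Rightarrow> real" where
  "christoffel N c k i j x =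
     (1/2) * (\<Sum>l\<in>UNIV. inv_metric N c x $ k $ l *
        (partial_deriv i (\<lambda>y. local_metric N c y $ j $ l) x
         + partial_deriv j (\<lambda>y. local_metric N c y $ i $ l) x
         - partial_deriv l (\<lambda>y. local_metric N c y $ i $ j) x))"


subsection \<open>Hessian and Laplacian\<close>

text \<open>A 1-form is given by its components \<open>\<omega> j\<close> in a chart; \<open>cov_deriv_form N c \<omega> i j\<close> is
  \<open>(\<nabla>\<^bsub>\<partial>\<^sub>i\<^esub> \<omega>)(\<partial>\<^sub>j)\<close>.\<close>

definition cov_deriv_form ::
    "('a, 'n::finite) riem_mfd \<Rightarrow> ('a, 'n) chart \<Rightarrow> ('n \<Rightarrow> real^'n \<Rightarrow> real) \<Rightarrow>
       'n \<Rightarrow> 'n \<Rightarrow> real^'n \<Rightarrow> real" where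
  "cov_deriv_form N c \<omega> i j x =
     partial_deriv i (\<omega> j) x - (\<Sum>k\<in>UNIV. christoffel N c k i j x * \<omega> k x)"

definition differential ::
    "('a, 'n::finite) chart \<Rightarrow> ('a \<Rightarrow> real) \<Rightarrow> 'n \<Rightarrow> real^'n \<Rightarrow> real" where
  "differential c u j = partial_deriv j (u \<circ> chart_inv c)"

definition hess ::
    "('a, 'n::finite) riem_mfd \<Rightarrow> ('a, 'n) chart \<Rightarrow> ('a \<Rightarrow> real) \<Rightarrow> real^'n \<Rightarrow> real^'n^'n" where
  "hess N c u x = (\<chi> i j. cov_deriv_form N c (differential c u) i j x)"

text \<open>Pointwise norm and trace, with respect to the metric, of the Hessian as a covariant
  2-tensor.\<close>

definition hess_norm :: "('a, 'n::finite) riem_mfd \<Rightarrow> ('a \<Rightarrow> real) \<Rightarrow> 'a \<Rightarrow> real" where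
  "hess_norm N u p =
     (let c = chart_at N p; x = snd c p; g' = inv_metric N c x; H = hess N c u x
      in sqrt (\<Sum>i\<in>UNIV. \<Sum>j\<in>UNIV. \<Sum>k\<in>UNIV. \<Sum>l\<in>UNIV.
                 g' $ i $ k * g' $ j $ l * H $ i $ j * H $ k $ l))"

definition laplacian :: "('a, 'n::finite) riem_mfd \<Rightarrow> ('a \<Rightarrow> real) \<Rightarrow> 'a \<Rightarrow> real" where
  "laplacian N u p =
     (let c = chart_at N p; x = snd c p; g' = inv_metric N c x; H = hess N c u x
      in - (\<Sum>i\<in>UNIV. \<Sum>j\<in>UNIV. g' $ i $ j * H $ i $ j))"


subsection \<open>Curvature\<close>

text \<open>\<open>riemann N c l i j k\<close> is the coefficient of \<open>\<partial>\<^sub>l\<close> in \<open>R(\<partial>\<^sub>i, \<partial>\<^sub>j) \<partial>\<^sub>k\<close>, where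
  \<open>R(X, Y) Z = \<nabla>\<^sub>X \<nabla>\<^sub>Y Z - \<nabla>\<^sub>Y \<nabla>\<^sub>X Z - \<nabla>\<^bsub>[X, Y]\<^esub> Z\<close>.\<close>

definition riemann ::
    "('a, 'n::finite) riem_mfd \<Rightarrow> ('a, 'n) chart \<Rightarrow> 'n \<Rightarrow> 'n \<Rightarrow> 'n \<Rightarrow> 'n \<Rightarrow> real^'n \<Rightarrow> real" where
  "riemann N c l i j k x =
     partial_deriv i (christoffel N c l j k) x - partial_deriv j (christoffel N c l i k) x
     + (\<Sum>m\<in>UNIV. christoffel N c m j k x * christoffel N c l i m x
                - christoffel N c m i k x * christoffel N c l j m x)"

text \<open>\<open>K = g(R(\<partial>\<^sub>1, \<partial>\<^sub>2) \<partial>\<^sub>2, \<partial>\<^sub>1) / det g\<close>; positive for round spheres.\<close>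

definition gaussian_curvature :: "('a, 2) riem_mfd \<Rightarrow> 'a \<Rightarrow> real" where
  "gaussian_curvature N p =
     (let c = chart_at N p; x = snd c p; g = local_metric N c x
      in (\<Sum>l\<in>UNIV. riemann N c l 1 2 2 x * g $ l $ 1) / det g)"


subsection \<open>Geodesics\<close>

text \<open>For open \<open>I\<close>: \<open>\<gamma>\<close> is continuous on \<open>I\<close> and in every chart twice differentiable
  with \<open>\<nabla>\<^bsub>\<gamma>'\<^esub> \<gamma>' = 0\<close> (and hence smooth).\<close>

definition geodesic_on :: "('a, 'n::finite) riem_mfd \<Rightarrow> real set \<Rightarrow> (real \<Rightarrow> 'a) \<Rightarrow> bool" where
  "geodesic_on N I \<gamma> \<longleftrightarrow>
     continuous_map (top_of_set I) (mtop N) \<gamma> \<and>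
     (\<forall>c\<in>atlas N. \<forall>t\<in>I. \<gamma> t \<in> fst c \<longrightarrow>
        (let x = snd c \<circ> \<gamma>; x' = (\<lambda>s. vector_derivative x (at s)) in
          x differentiable (at t) \<and>
          (x' has_vector_derivative
             (\<chi> k. - (\<Sum>i\<in>UNIV. \<Sum>j\<in>UNIV. christoffel N c k i j (x t) * x' t $ i * x' t $ j)))
            (at t)))"

text \<open>The exponential map is defined on the whole tangent bundle: through every point there is,
  for every initial velocity, a geodesic that is defined for all times.\<close>

definition geodesically_complete :: "('a, 'n::finite) riem_mfd \<Rightarrow> bool" where
  "geodesically_complete N \<longleftrightarrow>
     (\<forall>c\<in>atlas N. \<forall>p\<in>fst c. \<forall>v.
        \<exists>\<gamma>. geodesic_on N UNIV \<gamma> \<and> \<gamma> 0 = p \<and> vector_derivative (snd c \<circ> \<gamma>) (at 0) = v)"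


subsection \<open>Volume measure and \<open>L\<^sup>2\<close>-norms\<close>

text \<open>The unique Borel measure given by \<open>sqrt (det g) dx\<close> in every chart.\<close>

definition is_riemannian_volume :: "('a, 'n::finite) riem_mfd \<Rightarrow> 'a measure \<Rightarrow> bool" where
  "is_riemannian_volume N \<mu> \<longleftrightarrow>
     sets \<mu> = sets (sigma (topspace (mtop N)) {U. openin (mtop N) U}) \<and>
     (\<forall>c\<in>atlas N. \<forall>B\<in>sets \<mu>. B \<subseteq> fst c \<longrightarrow>
        emeasure \<mu> B = (\<integral>\<^sup>+x\<in>snd c ` B. ennreal (sqrt (det (local_metric N c x))) \<partial>lborel))"

definition riemannian_volume :: "('a, 'n::finite) riem_mfd \<Rightarrow> 'a measure" where
  "riemannian_volume N = (THE \<mu>. is_riemannian_volume N \<mu>)"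

text \<open>Only applied to functions that are continuous with compact support (and hence
  square-integrable).\<close>

definition L2_norm :: "('a, 'n::finite) riem_mfd \<Rightarrow> ('a \<Rightarrow> real) \<Rightarrow> real" where
  "L2_norm N f = sqrt (\<integral>p. (f p)\<^sup>2 \<partial>riemannian_volume N)"


section \<open>The Calderon-Zygmund inequality\<close>

definition test_functions :: "('a, 'n::finite) riem_mfd \<Rightarrow> ('a \<Rightarrow> real) set" where
  "test_functions N =
     {u. (\<forall>c\<in>atlas N. smooth_on (chart_image c) (u \<circ> chart_inv c)) \<and>
         compactin (mtop N) (mtop N closure_of {p \<in> topspace (mtop N). u p \<noteq> 0})}"

definition CZ2 :: "('a, 'n::finite) riem_mfd \<Rightarrow> bool" where
  "CZ2 N \<longleftrightarrow>
     (\<exists>C\<^sub>1 C\<^sub>2. C\<^sub>1 \<ge> 0 \<and> C\<^sub>2 > 0 \<and>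
        (\<forall>u\<in>test_functions N.
           L2_norm N (hess_norm N u) \<le> C\<^sub>1 * L2_norm N u + C\<^sub>2 * L2_norm N (laplacian N u)))"


section \<open>Characterisation of the Christoffel symbols\<close>

lemma smooth_on_imp_differentiable:
  "smooth_on S f \<Longrightarrow> x \<in> S \<Longrightarrow> f differentiable (at x)"
  unfolding smooth_on_def by (metis C_k_on.simps(2))

lemma partial_deriv_cong:
  assumes "open S" "x \<in> S" "\<And>y. y \<in> S \<Longrightarrow> f y = h y" "f differentiable (at x)"
  shows "partial_deriv i f x = partial_deriv i h x"
  using frechet_derivative_transform_within_open[OF assms(4,1,2)] assms(3)
  unfolding partial_deriv_def by metis

theorem levi_civita_unique:
  fixes N :: "('a, 'n::finite) riem_mfd" and \<Gamma> :: "'n \<Rightarrow> 'n \<Rightarrow> 'n \<Rightarrow> real"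
  assumes N: "riemannian_manifold N" and c: "c \<in> atlas N" and x: "x \<in> chart_image c"
  defines "g \<equiv> local_metric N c"
  shows "(\<forall>k i j. \<Gamma> k i j = christoffel N c k i j x) \<longleftrightarrow>
         (\<forall>k i j. \<Gamma> k i j = \<Gamma> k j i) \<and>
         (\<forall>i j l. partial_deriv i (\<lambda>y. g y $ j $ l) x =
                  (\<Sum>k\<in>UNIV. \<Gamma> k i j * g x $ k $ l) + (\<Sum>k\<in>UNIV. \<Gamma> k i l * g x $ j $ k))"
proof -
  have inv: "chart_inv c y \<in> fst c" if "y \<in> chart_image c" for y
    using that unfolding chart_inv_def chart_image_def by (simp add: inv_into_into)
  have op: "open (chart_image c)"
    using N c unfolding riemannian_manifold_def smooth_manifold_def by blast
  have tr: "transpose (g y) = g y" if "y \<in> chart_image c" for y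
    using N c inv[OF that] unfolding riemannian_manifold_def g_def local_metric_def by blast
  have sym: "g y $ i $ j = g y $ j $ i" if "y \<in> chart_image c" for y i j
    using arg_cong[OF tr[OF that], of "\<lambda>M. M $ j $ i"] by (simp add: transpose_def)
  have diff: "(\<lambda>y. g y $ i $ j) differentiable (at x)" for i j
  proof -
    have "g differentiable (at x)"
      using N c x smooth_on_imp_differentiable unfolding riemannian_manifold_def g_def by blast
    then show ?thesis
      unfolding differentiable_def
      by (metis bounded_linear.has_derivative[OF bounded_linear_vec_nth])
  qed
  define d where "d i j l = partial_deriv i (\<lambda>y. g y $ j $ l) x" for i j l
  have dsym: "d i j l = d i l j" for i j l
    unfolding d_def by (rule partial_deriv_cong[OF op x]) (use sym diff in auto)
  have "invertible (g x)"
  proof -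
    have "v = 0" if "g x *v v = 0" for v
    proof (rule ccontr)
      assume "v \<noteq> 0"
      then have "v \<bullet> (g x *v v) > 0"
        using N c inv[OF x] unfolding riemannian_manifold_def g_def local_metric_def by blast
      with that show False by simp
    qed
    then show ?thesis
      by (simp add: invertible_left_inverse matrix_left_invertible_ker)
  qed
  then have gi: "g x ** matrix_inv (g x) = mat 1" "matrix_inv (g x) ** g x = mat 1"
    unfolding invertible_def matrix_inv_def by (metis (mono_tags, lifting) someI_ex)+
  define h where "h = matrix_inv (g x)"
  have gh: "(\<Sum>k\<in>UNIV. g x $ l $ k * h $ k $ m) = (if l = m then 1 else 0)" for l m
    using arg_cong[OF gi(1), of "\<lambda>M. M $ l $ m"]
    by (simp add: h_def matrix_matrix_mult_def mat_def)
  have hg: "(\<Sum>l\<in>UNIV. h $ k $ l * g x $ l $ m) = (if k = m then 1 else 0)" for k m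
    using arg_cong[OF gi(2), of "\<lambda>M. M $ k $ m"]
    by (simp add: h_def matrix_matrix_mult_def mat_def)
  have delta: "(\<Sum>m\<in>UNIV. (if a = m then 1 else 0) * z m) = z a" for a :: 'n and z :: "'n \<Rightarrow> real"
    by (simp add: if_distrib[of "\<lambda>y. y * _"] cong: if_cong)
  have chr: "christoffel N c k i j x = (1/2) * (\<Sum>l\<in>UNIV. h $ k $ l * (d i j l + d j i l - d l i j))"
    for k i j
    by (simp add: christoffel_def inv_metric_def h_def d_def g_def)
  have low: "(\<Sum>k\<in>UNIV. g x $ l $ k * christoffel N c k i j x) = (1/2) * (d i j l + d j i l - d l i j)"
    for l i j
  proof -
    have "(\<Sum>k\<in>UNIV. g x $ l $ k * christoffel N c k i j x)
        = (\<Sum>k\<in>UNIV. \<Sum>m\<in>UNIV. (g x $ l $ k * h $ k $ m) * ((1/2) * (d i j m + d j i m - d m i j)))"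
      unfolding chr sum_distrib_left by (intro sum.cong) (simp_all add: algebra_simps)
    also have "\<dots> = (\<Sum>m\<in>UNIV. (\<Sum>k\<in>UNIV. g x $ l $ k * h $ k $ m) * ((1/2) * (d i j m + d j i m - d m i j)))"
      unfolding sum_distrib_right by (rule sum.swap)
    also have "\<dots> = (1/2) * (d i j l + d j i l - d l i j)"
      unfolding gh delta ..
    finally show ?thesis .
  qed
  show ?thesis (is "?L \<longleftrightarrow> ?S \<and> ?C")
  proof (intro iffI)
    assume L: ?L
    have ?S
    proof (intro allI)
      fix k i j
      have "d i j l + d j i l - d l i j = d j i l + d i j l - d l j i" for l
        using dsym[of l i j] by simp
      then show "\<Gamma> k i j = \<Gamma> k j i"
        using L unfolding chr by presburger
    qed
    moreover have ?C
    proof (intro allI)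
      fix i j l
      have "(\<Sum>k\<in>UNIV. \<Gamma> k i j * g x $ k $ l) = (\<Sum>k\<in>UNIV. g x $ l $ k * christoffel N c k i j x)"
        using L sym[OF x] by (intro sum.cong) (simp_all add: mult.commute)
      moreover have "(\<Sum>k\<in>UNIV. \<Gamma> k i l * g x $ j $ k) = (\<Sum>k\<in>UNIV. g x $ j $ k * christoffel N c k i l x)"
        using L by (intro sum.cong) (simp_all add: mult.commute)
      ultimately show "partial_deriv i (\<lambda>y. g y $ j $ l) x =
          (\<Sum>k\<in>UNIV. \<Gamma> k i j * g x $ k $ l) + (\<Sum>k\<in>UNIV. \<Gamma> k i l * g x $ j $ k)"
        unfolding low d_def[symmetric]
        using dsym[of i j l] dsym[of j l i] dsym[of l i j] by simp
    qed
    ultimately show "?S \<and> ?C" ..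
  next
    assume "?S \<and> ?C"
    then have S: "\<And>k i j. \<Gamma> k i j = \<Gamma> k j i"
      and C: "\<And>i j l. d i j l =
          (\<Sum>k\<in>UNIV. \<Gamma> k i j * g x $ k $ l) + (\<Sum>k\<in>UNIV. \<Gamma> k i l * g x $ j $ k)"
      unfolding d_def by blast+
    define G where "G i j l = (\<Sum>k\<in>UNIV. g x $ l $ k * \<Gamma> k i j)" for i j l
    have Gs: "G i j l = G j i l" for i j l
      unfolding G_def using S by metis
    have dG: "d i j l = G i j l + G i l j" for i j l
      unfolding C G_def using sym[OF x] by (simp add: mult.commute)
    have G: "G i j l = (1/2) * (d i j l + d j i l - d l i j)" for i j l
      unfolding dG using Gs[of i j l] Gs[of i l j] Gs[of j l i] by simp
    show ?L
    proof (intro allI)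
      fix k i j
      have "christoffel N c k i j x = (\<Sum>l\<in>UNIV. h $ k $ l * G i j l)"
        unfolding chr G sum_distrib_left by (intro sum.cong) (simp_all add: algebra_simps)
      also have "\<dots> = (\<Sum>l\<in>UNIV. \<Sum>m\<in>UNIV. (h $ k $ l * g x $ l $ m) * \<Gamma> m i j)"
        unfolding G_def sum_distrib_left by (simp add: mult.assoc)
      also have "\<dots> = (\<Sum>m\<in>UNIV. (\<Sum>l\<in>UNIV. h $ k $ l * g x $ l $ m) * \<Gamma> m i j)"
        unfolding sum_distrib_right by (rule sum.swap)
      also have "\<dots> = \<Gamma> k i j"
        unfolding hg delta ..
      finally show "\<Gamma> k i j = christoffel N c k i j x" by simp
    qed
  qed
qed

end

theory Submission
  imports Defs
begin

text \<open>On the plane take the metric \<open>dx\<^sup>2 + f(x)\<^sup>2 dy\<^sup>2\<close> with \<open>f(x) = (1 + x\<^sup>2) / (2 + sin (x\<^sup>2))\<close>.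
  Clairaut's integral reduces geodesics to \<open>x'' = L\<^sup>2 f'(x) / f(x)\<^sup>3\<close>, whose right-hand side is bounded
  and globally Lipschitz, so they exist for all times; and the curvature \<open>- f'' / f\<close> grows like \<open>x\<^sup>2\<close>
  at the maxima of \<open>sin (x\<^sup>2)\<close>. In the coordinate \<open>s = \<integral> dx / f\<close> the metric is conformal to
  \<open>ds\<^sup>2 + dy\<^sup>2\<close>, hence the Laplacian of \<open>b(s) b(y)\<close> does not see \<open>f'\<close>, whereas
  the Hessian contains \<open>- b'(s) b(y) f' / f\<^sup>2\<close>. Put a bump of fixed size in \<open>x\<close> and \<open>y\<close>
  at \<open>X\<close> with \<open>X\<^sup>2 \<in> 2 \<pi> \<nat>\<close>: relative to the volume of its support, the squares of the
  \<open>L\<^sup>2\<close>-norms of the function and its Laplacian stay bounded, but the Hessian is of size \<open>X\<close> on a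
  strip of width \<open>1 / X\<close>, so the square of its norm grows like \<open>X\<close>.\<close>

section \<open>Smooth functions\<close>

text \<open>This rule and its converse below let derivatives be supplied by hand; uniqueness of the
  Frechet derivative ties them to the definition.\<close>

lemma C_k_on_UNIV_SucI:
  assumes "\<And>x. (f has_derivative D x) (at x)" "\<And>v. C_k_on k UNIV (\<lambda>x. D x v)"
  shows "C_k_on (Suc k) UNIV f"
proof -
  have "frechet_derivative f (at x) = D x" for x
    using frechet_derivative_at[OF assms(1)] by simp
  then show ?thesis
    using assms by (auto simp: differentiable_def)
qed

lemma C_k_on_UNIV_SucE:
  assumes "C_k_on (Suc k) UNIV f"
  obtains D where "\<And>x. (f has_derivative D x) (at x)" "\<And>v. C_k_on k UNIV (\<lambda>x. D x v)"
proof (rule that)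
  show "(f has_derivative frechet_derivative f (at x)) (at x)" for x
    using assms by (simp add: frechet_derivative_works[symmetric])
  show "C_k_on k UNIV (\<lambda>x. frechet_derivative f (at x) v)" for v
    using assms by simp
qed

text \<open>The product, quotient and chain rules leave undifferentiated factors behind; in an
  induction on the order these must be known to be of the lower order too.\<close>

lemma C_k_on_Suc_imp: "C_k_on (Suc k) S f \<Longrightarrow> C_k_on k S f"
proof (induction k arbitrary: f)
  case 0
  then show ?case
    by (auto intro!: continuous_at_imp_continuous_on differentiable_imp_continuous_within)
qed auto

lemma C_k_on_const: "C_k_on k S (\<lambda>x. c)"
  by (induction k arbitrary: c) auto

lemma C_k_on_linear_compose:
  assumes "bounded_linear L" "C_k_on k UNIV f"
  shows "C_k_on k UNIV (\<lambda>x. L (f x))"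
  using assms(2)
proof (induction k arbitrary: f)
  case 0
  then show ?case
    using bounded_linear.continuous_on[OF assms(1)] by simp
next
  case (Suc k)
  obtain D where D: "\<And>x. (f has_derivative D x) (at x)" "\<And>v. C_k_on k UNIV (\<lambda>x. D x v)"
    using Suc.prems by (rule C_k_on_UNIV_SucE) blast
  show ?case
    by (rule C_k_on_UNIV_SucI[where D = "\<lambda>x v. L (D x v)"])
      (auto intro: bounded_linear.has_derivative[OF assms(1)] Suc.IH D)
qed

lemma C_k_on_bounded_linear:
  assumes "bounded_linear L"
  shows "C_k_on k UNIV L"
proof (cases k)
  case 0
  then show ?thesis using assms by (simp add: linear_continuous_on)
next
  case (Suc m)
  show ?thesis
    unfolding Suc
    by (rule C_k_on_UNIV_SucI[where D = "\<lambda>x. L"])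
      (auto intro: bounded_linear_imp_has_derivative assms C_k_on_const)
qed

lemma C_k_on_add:
  assumes "C_k_on k UNIV f" "C_k_on k UNIV g"
  shows "C_k_on k UNIV (\<lambda>x. f x + g x)"
  using assms
proof (induction k arbitrary: f g)
  case 0
  then show ?case by (simp add: continuous_on_add)
next
  case (Suc k)
  obtain D where D: "\<And>x. (f has_derivative D x) (at x)" "\<And>v. C_k_on k UNIV (\<lambda>x. D x v)"
    using Suc.prems(1) by (rule C_k_on_UNIV_SucE) blast
  obtain E where E: "\<And>x. (g has_derivative E x) (at x)" "\<And>v. C_k_on k UNIV (\<lambda>x. E x v)"
    using Suc.prems(2) by (rule C_k_on_UNIV_SucE) blast
  show ?case
    by (rule C_k_on_UNIV_SucI[where D = "\<lambda>x v. D x v + E x v"])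
      (auto intro: has_derivative_add Suc.IH D E)
qed

lemma C_k_on_mult:
  fixes f g :: "'a::real_normed_vector \<Rightarrow> real"
  assumes "C_k_on k UNIV f" "C_k_on k UNIV g"
  shows "C_k_on k UNIV (\<lambda>x. f x * g x)"
  using assms
proof (induction k arbitrary: f g)
  case 0
  then show ?case by (simp add: continuous_on_mult)
next
  case (Suc k)
  obtain D where D: "\<And>x. (f has_derivative D x) (at x)" "\<And>v. C_k_on k UNIV (\<lambda>x. D x v)"
    using Suc.prems(1) by (rule C_k_on_UNIV_SucE) blast
  obtain E where E: "\<And>x. (g has_derivative E x) (at x)" "\<And>v. C_k_on k UNIV (\<lambda>x. E x v)"
    using Suc.prems(2) by (rule C_k_on_UNIV_SucE) blast
  show ?case
    by (rule C_k_on_UNIV_SucI[where D = "\<lambda>x v. f x * E x v + D x v * g x"])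
      (intro has_derivative_mult D E,
        intro C_k_on_add Suc.IH D E Suc.prems[THEN C_k_on_Suc_imp])
qed

lemma C_k_on_inverse:
  fixes f :: "'a::real_normed_vector \<Rightarrow> real"
  assumes "C_k_on k UNIV f" "\<And>x. f x \<noteq> 0"
  shows "C_k_on k UNIV (\<lambda>x. inverse (f x))"
  using assms(1)
proof (induction k)
  case 0
  then show ?case using assms(2) by (simp add: continuous_on_inverse)
next
  case (Suc k)
  obtain D where D: "\<And>x. (f has_derivative D x) (at x)" "\<And>v. C_k_on k UNIV (\<lambda>x. D x v)"
    using Suc.prems by (rule C_k_on_UNIV_SucE) blast
  have I: "C_k_on k UNIV (\<lambda>x. inverse (f x))"
    using Suc C_k_on_Suc_imp by blast
  have "C_k_on k UNIV (\<lambda>x. (- 1) * (inverse (f x) * D x v * inverse (f x)))" for v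
    by (intro C_k_on_mult C_k_on_const I D)
  then have "C_k_on k UNIV (\<lambda>x. - (inverse (f x) * D x v * inverse (f x)))" for v
    by simp
  then show ?case
    using Deriv.has_derivative_inverse[OF assms(2) D(1)]
    by (intro C_k_on_UNIV_SucI[where D = "\<lambda>x v. - (inverse (f x) * D x v * inverse (f x))"])
qed

text \<open>The outer function lives on the real line, so the chain rule yields a product of real
  functions and \<open>C_k_on_mult\<close> closes the induction. It generalises over
  \<open>g\<close> because \<open>g\<close> is replaced by its derivative.\<close>

lemma C_k_on_compose:
  fixes g :: "real \<Rightarrow> real" and f :: "'a::real_normed_vector \<Rightarrow> real"
  assumes "C_k_on k UNIV g" "C_k_on k UNIV f"
  shows "C_k_on k UNIV (\<lambda>x. g (f x))"
  using assms
proof (induction k arbitrary: g)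
  case 0
  then show ?case using continuous_on_compose2[of UNIV g UNIV f] by simp
next
  case (Suc k)
  obtain D where D: "\<And>x. (f has_derivative D x) (at x)" "\<And>v. C_k_on k UNIV (\<lambda>x. D x v)"
    using Suc.prems(2) by (rule C_k_on_UNIV_SucE) blast
  obtain E where E: "\<And>x. (g has_derivative E x) (at x)" "\<And>v. C_k_on k UNIV (\<lambda>x. E x v)"
    using Suc.prems(1) by (rule C_k_on_UNIV_SucE) blast
  have lin: "E y v = v * E y 1" for y v
    using linear_scale[OF has_derivative_linear[OF E(1)], of y v 1] by simp
  have "C_k_on k UNIV (\<lambda>x. D x v * E (f x) 1)" for v
    by (intro C_k_on_mult D Suc.IH[of "\<lambda>y. E y 1"] E Suc.prems(2)[THEN C_k_on_Suc_imp])
  moreover have "((\<lambda>x. g (f x)) has_derivative (\<lambda>v. D x v * E (f x) 1)) (at x)" for x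
  proof -
    have "((\<lambda>x. g (f x)) has_derivative (\<lambda>v. E (f x) (D x v))) (at x)"
      by (rule has_derivative_compose[OF D(1) E(1)])
    then show ?thesis
      by (subst (asm) lin)
  qed
  ultimately show ?case
    by (intro C_k_on_UNIV_SucI)
qed

text \<open>Meant for families closed under differentiation: the span of sine and cosine, and the
  functions \<open>flat p\<close>.\<close>

lemma C_k_on_real_coinduct:
  fixes f :: "real \<Rightarrow> real"
  assumes "P f"
    and "\<And>g. P g \<Longrightarrow> \<exists>g'. P g' \<and> (\<forall>x. (g has_real_derivative g' x) (at x))"
  shows "C_k_on k UNIV f"
  using assms(1)
proof (induction k arbitrary: f)
  case 0
  then show ?case
    using assms(2)[OF 0] DERIV_isCont by (auto intro!: continuous_at_imp_continuous_on)
next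
  case (Suc k)
  then obtain g where g: "P g" "\<And>x. (f has_real_derivative g x) (at x)"
    using assms(2) by blast
  show ?case
    using g Suc.IH
    by (intro C_k_on_UNIV_SucI[where D = "\<lambda>x v. g x * v"] C_k_on_mult C_k_on_const)
      (auto simp: has_field_derivative_def)
qed

text \<open>Serves \<open>conf_coord\<close>, which is known only through its derivative.\<close>

lemma C_k_on_antiderivative:
  fixes f :: "real \<Rightarrow> real"
  assumes "\<And>x. (f has_real_derivative g x) (at x)" "\<And>k. C_k_on k UNIV g"
  shows "C_k_on k UNIV f"
proof (rule C_k_on_Suc_imp, rule C_k_on_UNIV_SucI)
  show "(f has_derivative (*) (g x)) (at x)" for x
    using assms(1) by (simp add: has_field_derivative_def)
qed (intro C_k_on_mult C_k_on_const assms)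

lemma C_k_on_sin: "C_k_on k UNIV (sin :: real \<Rightarrow> real)"
proof (rule C_k_on_real_coinduct[where P = "\<lambda>g. \<exists>a b. g = (\<lambda>x. a * sin x + b * cos x)"])
  show "\<exists>a b. sin = (\<lambda>x::real. a * sin x + b * cos x)"
    by (intro exI[of _ 1] exI[of _ 0]) auto
next
  fix g :: "real \<Rightarrow> real"
  assume "\<exists>a b. g = (\<lambda>x. a * sin x + b * cos x)"
  then obtain a b where g: "g = (\<lambda>x. a * sin x + b * cos x)" by blast
  show "\<exists>g'. (\<exists>a b. g' = (\<lambda>x. a * sin x + b * cos x)) \<and> (\<forall>x. (g has_real_derivative g' x) (at x))"
    unfolding g
    by (rule exI[of _ "\<lambda>x. - b * sin x + a * cos x"], intro conjI exI allI, rule refl)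
      (auto intro!: derivative_eq_intros)
qed

subsection \<open>A bump function\<close>

text \<open>The classical flat function exp (- 1 / t), continued by 0. The polynomial factor in 1 /
  t makes the family closed under differentiation.\<close>

definition flat :: "real poly \<Rightarrow> real \<Rightarrow> real" where
  "flat p t = (if t \<le> 0 then 0 else poly p (1 / t) * exp (- (1 / t)))"

lemma poly_times_exp_minus_tendsto_0:
  fixes p :: "real poly"
  shows "((\<lambda>x. poly p x * exp (- x)) \<longlongrightarrow> 0) at_top"
proof -
  have "((\<lambda>x. \<Sum>i\<le>degree p. coeff p i * (x ^ i / exp x)) \<longlongrightarrow> (\<Sum>i\<le>degree p. coeff p i * 0)) at_top"
    by (intro tendsto_sum tendsto_mult tendsto_const tendsto_power_div_exp_0)
  then show ?thesis
    unfolding poly_altdef by (simp add: sum_distrib_right exp_minus divide_inverse mult.assoc)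
qed

text \<open>For t > 0, differentiating p (1 / t) exp (- 1 / t) brings out the factor 1 / t^2, which
  is the polynomial \<open>[:0, 0, 1:]\<close>, times p - p'. At 0 the exponential beats every
  polynomial in 1 / t.\<close>

lemma flat_has_derivative:
  "(flat p has_real_derivative flat ([:0, 0, 1:] * (p - pderiv p)) t) (at t)"
proof (cases t "0 :: real" rule: linorder_cases)
  case less
  have "((\<lambda>_. 0) has_real_derivative 0) (at t)" by simp
  then have "(flat p has_real_derivative 0) (at t)"
    by (rule has_field_derivative_transform_within_open[where S = "{..<0}"])
      (use less in \<open>auto simp: flat_def\<close>)
  then show ?thesis using less by (simp add: flat_def)
next
  case greater
  have "((\<lambda>t. poly p (1 / t) * exp (- (1 / t))) has_real_derivative
      flat ([:0, 0, 1:] * (p - pderiv p)) t) (at t)"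
  proof -
    have "((\<lambda>t. poly p (1 / t) * exp (- (1 / t))) has_real_derivative
      poly p (1 / t) * (exp (- (1 / t)) * (1 / t\<^sup>2)) + poly (pderiv p) (1 / t) * (- 1 / t\<^sup>2) * exp (- (1 / t))) (at t)"
      using greater
      by (auto intro!: derivative_eq_intros DERIV_chain2[OF poly_DERIV] simp: power2_eq_square)
    then show ?thesis
      using greater by (simp add: flat_def algebra_simps power2_eq_square)
  qed
  then show ?thesis
    by (rule has_field_derivative_transform_within_open[where S = "{0<..}"])
      (use greater in \<open>auto simp: flat_def\<close>)
next
  case equal
  \<comment> \<open>Dividing by t multiplies the polynomial by its variable, so the right difference
    quotient at 0 is again of this form.\<close>
  have "((\<lambda>t. poly ([:0, 1:] * p) (1 / t) * exp (- (1 / t))) \<longlongrightarrow> 0) (at_right 0)"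
    using poly_times_exp_minus_tendsto_0[of "[:0, 1:] * p"]
    by (rule filterlim_compose) (simp add: filterlim_inverse_at_top_right flip: inverse_eq_divide)
  then have R: "((\<lambda>t. (flat p t - flat p 0) / (t - 0)) \<longlongrightarrow> 0) (at_right 0)"
    by (rule tendsto_cong[THEN iffD1, rotated])
      (auto simp: flat_def eventually_at_filter field_simps)
  have L: "((\<lambda>t. (flat p t - flat p 0) / (t - 0)) \<longlongrightarrow> 0) (at_left 0)"
    by (rule tendsto_cong[THEN iffD1, OF _ tendsto_const])
      (auto simp: flat_def eventually_at_filter)
  have "(flat p has_real_derivative 0) (at 0)"
    unfolding has_field_derivative_iff using filterlim_split_at_real[OF L R] by simp
  then show ?thesis using equal by (simp add: flat_def)
qed

lemma C_k_on_flat: "C_k_on k UNIV (flat p)"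
proof (rule C_k_on_real_coinduct[where P = "\<lambda>g. \<exists>p. g = flat p"])
  show "\<exists>p'. flat p = flat p'" by blast
next
  fix g assume "\<exists>p. g = flat p"
  then obtain p where "g = flat p" by blast
  then show "\<exists>g'. (\<exists>p. g' = flat p) \<and> (\<forall>x. (g has_real_derivative g' x) (at x))"
    using flat_has_derivative[of p] by (intro exI[of _ "flat ([:0, 0, 1:] * (p - pderiv p))"]) auto
qed

definition bump :: "real \<Rightarrow> real" where
  "bump t = flat 1 (1 - t\<^sup>2)"

text \<open>The polynomials here and in \<open>bump2\<close> are those of
  \<open>flat_has_derivative\<close>, with variable z: first z^2 (1 - 0), then z^2 (z^2 - 2 z). The
  remaining factors come from the inner function 1 - t^2.\<close>

definition bump1 :: "real \<Rightarrow> real" where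
  "bump1 t = flat [:0, 0, 1:] (1 - t\<^sup>2) * (- 2 * t)"

definition bump2 :: "real \<Rightarrow> real" where
  "bump2 t = flat ([:0, 0, 1:] * ([:0, 0, 1:] - [:0, 2:])) (1 - t\<^sup>2) * (- 2 * t) * (- 2 * t)
     + flat [:0, 0, 1:] (1 - t\<^sup>2) * (- 2)"

lemma bump_has_derivative: "(bump has_real_derivative bump1 t) (at t)"
  unfolding bump_def[abs_def] bump1_def
  by (rule DERIV_chain2[OF flat_has_derivative[of 1, simplified pderiv_1], THEN DERIV_cong])
    (auto intro!: derivative_eq_intros)

lemma bump1_has_derivative: "(bump1 has_real_derivative bump2 t) (at t)"
proof -
  have [simp]: "pderiv [:0, 0, 1::real:] = [:0, 2:]"
    by (simp add: pderiv_pCons)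
  have "((\<lambda>t. flat [:0, 0, 1:] (1 - t\<^sup>2)) has_real_derivative
      flat ([:0, 0, 1:] * ([:0, 0, 1:] - [:0, 2:])) (1 - t\<^sup>2) * (- 2 * t)) (at t)"
    by (rule DERIV_chain2[OF flat_has_derivative[of "[:0, 0, 1:]"], THEN DERIV_cong])
      (auto intro!: derivative_eq_intros)
  then show ?thesis
    unfolding bump1_def[abs_def] bump2_def
    by (rule DERIV_mult[THEN DERIV_cong]) (auto intro!: derivative_eq_intros)
qed

lemma C_k_on_bump: "C_k_on k UNIV bump"
proof -
  have "C_k_on k UNIV (\<lambda>t::real. 1 + (- 1) * (t * t))"
    by (intro C_k_on_add C_k_on_mult C_k_on_const C_k_on_bounded_linear bounded_linear_ident)
  from C_k_on_compose[OF C_k_on_flat this, of 1] show ?thesis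
    by (simp add: bump_def[abs_def] power2_eq_square)
qed

lemma bump_eq_0:
  assumes "\<bar>t\<bar> \<ge> 1"
  shows "bump t = 0" "bump1 t = 0" "bump2 t = 0"
proof -
  have "1 \<le> t\<^sup>2" using assms by (metis abs_le_square_iff abs_one one_power2)
  then show "bump t = 0" "bump1 t = 0" "bump2 t = 0"
    by (simp_all add: bump_def bump1_def bump2_def flat_def)
qed

lemma bump_pos:
  assumes "\<bar>t\<bar> < 1"
  shows "bump t > 0"
proof -
  have "t\<^sup>2 < 1" using assms by (simp add: abs_square_less_1)
  then show ?thesis by (simp add: bump_def flat_def)
qed

lemma bump1_pos:
  assumes "- 1 < t" "t < 0"
  shows "bump1 t > 0"
proof -
  have "t\<^sup>2 < 1" using assms by (simp add: abs_square_less_1)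
  then have "flat [:0, 0, 1:] (1 - t\<^sup>2) > 0" by (simp add: flat_def)
  then show ?thesis unfolding bump1_def by (rule mult_pos_pos) (use assms in simp)
qed

lemma isCont_bump2: "isCont bump2 t"
  unfolding bump2_def[abs_def]
  by (intro continuous_intros isCont_o2[OF _ DERIV_isCont[OF flat_has_derivative]])

lemma continuous_on_bumps:
  "continuous_on S bump" "continuous_on S bump1" "continuous_on S bump2"
  using bump_has_derivative bump1_has_derivative isCont_bump2 DERIV_isCont
  by (blast intro: continuous_at_imp_continuous_on)+

lemma bumps_bounded:
  obtains B where "B \<ge> 1" "\<And>t. \<bar>bump t\<bar> \<le> B" "\<And>t. \<bar>bump1 t\<bar> \<le> B" "\<And>t. \<bar>bump2 t\<bar> \<le> B"
proof -
  have *: "\<exists>B. \<forall>t. \<bar>g t\<bar> \<le> B" if "continuous_on {-1..1} g" "\<And>t. \<bar>t\<bar> \<ge> 1 \<Longrightarrow> g t = 0" for g :: "real \<Rightarrow> real"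
  proof -
    have "bounded (g ` {-1..1})"
      using that(1) by (intro compact_imp_bounded compact_continuous_image) auto
    then obtain B where B: "\<forall>t\<in>{-1..1}. \<bar>g t\<bar> \<le> B"
      unfolding bounded_iff by auto
    have "0 \<le> B" using bspec[OF B, of 0] by simp
    then have "\<bar>g t\<bar> \<le> B" for t
      using B that(2)[of t] by (cases "t \<in> {-1..1}") (blast, auto)
    then show ?thesis by blast
  qed
  obtain B0 B1 B2 where B: "\<And>t. \<bar>bump t\<bar> \<le> B0" "\<And>t. \<bar>bump1 t\<bar> \<le> B1" "\<And>t. \<bar>bump2 t\<bar> \<le> B2"
    using *[of bump] *[of bump1] *[of bump2] bump_eq_0 continuous_on_bumps by blast
  show thesis
    by (rule that[of "max 1 (max B0 (max B1 B2))"]) (use B in \<open>auto simp: le_max_iff_disj\<close>)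
qed

section \<open>A second-order differential equation\<close>

lemma antiderivative_exists:
  fixes g :: "real \<Rightarrow> real"
  assumes "continuous_on UNIV g"
  shows "\<exists>G. G 0 = 0 \<and> (\<forall>t. (G has_real_derivative g t) (at t))"
proof -
  obtain F where F: "\<And>t. (F has_vector_derivative g t) (at t)"
    using einterval_antiderivative[of "-\<infinity>" "\<infinity>" g] assms
    by (auto simp: continuous_on_eq_continuous_at)
  have "((\<lambda>t. F t - F 0) has_real_derivative g t) (at t)" for t
    using F[of t] unfolding has_real_derivative_iff_has_vector_derivative
    by (auto intro!: derivative_eq_intros)
  then show ?thesis
    by (intro exI[of _ "\<lambda>t. F t - F 0"]) simp
qed

text \<open>A choice normalised at 0 serves both half-lines at once, without integrals whose limits
  change order.\<close>

definition antideriv :: "(real \<Rightarrow> real) \<Rightarrow> real \<Rightarrow> real" where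
  "antideriv g = (SOME G. G 0 = 0 \<and> (\<forall>t. (G has_real_derivative g t) (at t)))"

lemma antideriv:
  assumes "continuous_on UNIV g"
  shows antideriv_0: "antideriv g 0 = 0"
    and antideriv_has_derivative: "(antideriv g has_real_derivative g t) (at t)"
  using someI_ex[OF antiderivative_exists[OF assms]] by (auto simp: antideriv_def)

lemma continuous_on_antideriv:
  "continuous_on UNIV g \<Longrightarrow> continuous_on S (antideriv g)"
  using antideriv_has_derivative DERIV_isCont by (blast intro: continuous_at_imp_continuous_on)

text \<open>The difference of the right-hand side and \<open>G\<close> is nondecreasing on the
  half-line, and it starts at C / l, which is not negative.\<close>

lemma exp_growth_upper_bound:
  fixes G g :: "real \<Rightarrow> real"
  assumes "0 < l" "0 \<le> C" "G 0 = 0" "\<And>t. (G has_real_derivative g t) (at t)"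
    "\<And>t. \<bar>g t\<bar> \<le> C * exp (l * \<bar>t\<bar>)" "0 \<le> t"
  shows "G t \<le> C / l * exp (l * t)"
proof -
  have "C / l * exp (l * 0) - G 0 \<le> C / l * exp (l * t) - G t"
  proof (rule DERIV_nonneg_imp_nondecreasing[OF assms(6)])
    fix s assume s: "0 \<le> s" "s \<le> t"
    have "((\<lambda>s. C / l * exp (l * s) - G s) has_real_derivative C * exp (l * s) - g s) (at s)"
      using assms(1) by (auto intro!: derivative_eq_intros assms(4))
    moreover have "0 \<le> C * exp (l * s) - g s"
      using assms(5)[of s] s by simp
    ultimately show "\<exists>y. ((\<lambda>s. C / l * exp (l * s) - G s) has_real_derivative y) (at s) \<and> 0 \<le> y"
      by blast
  qed
  moreover have "0 \<le> C / l" using assms(1,2) by simp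
  ultimately show ?thesis using assms(3) by simp
qed

text \<open>Reflecting the time and the sign reduces all four cases to the one-sided bound.\<close>

lemma exp_growth_bound:
  fixes G g :: "real \<Rightarrow> real"
  assumes "0 < l" "0 \<le> C" "G 0 = 0" "\<And>t. (G has_real_derivative g t) (at t)"
    "\<And>t. \<bar>g t\<bar> \<le> C * exp (l * \<bar>t\<bar>)"
  shows "\<bar>G t\<bar> \<le> C / l * exp (l * \<bar>t\<bar>)"
proof -
  have D: "((\<lambda>t. - G t) has_real_derivative - g t) (at t)"
    "((\<lambda>t. G (- t)) has_real_derivative - g (- t)) (at t)"
    "((\<lambda>t. - G (- t)) has_real_derivative g (- t)) (at t)" for t
    using DERIV_minus[OF assms(4)] DERIV_chain2[OF assms(4) DERIV_minus[OF DERIV_ident], of t]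
      DERIV_minus[OF DERIV_chain2[OF assms(4) DERIV_minus[OF DERIV_ident], of t]]
    by simp_all
  have b: "\<bar>- g t\<bar> \<le> C * exp (l * \<bar>t\<bar>)" "\<bar>- g (- t)\<bar> \<le> C * exp (l * \<bar>t\<bar>)"
    "\<bar>g (- t)\<bar> \<le> C * exp (l * \<bar>t\<bar>)" for t
    using assms(5)[of t] assms(5)[of "- t"] by auto
  note up = exp_growth_upper_bound[OF assms(1,2)]
  show ?thesis
  proof (cases "t \<ge> 0")
    case True
    then show ?thesis
      using up[OF _ assms(4,5), of t] up[OF _ D(1) b(1), of t] assms(3) by simp
  next
    case False
    then show ?thesis
      using up[OF _ D(2) b(2), of "- t"] up[OF _ D(3) b(3), of "- t"] assms(3) by simp
  qed
qed

text \<open>The fixed point is sought among the accelerations \<open>a\<close>, which are bounded. Weighting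
  them by \<open>exp (- l \<bar>t\<bar>)\<close> makes the Picard map a contraction globally in time.\<close>

theorem second_order_ode_global:
  fixes F :: "real \<Rightarrow> real"
  assumes M: "\<And>x. \<bar>F x\<bar> \<le> M" and K: "\<And>x y. \<bar>F x - F y\<bar> \<le> K * \<bar>x - y\<bar>"
  obtains x v where "x 0 = x0" "v 0 = v0" "\<And>t. (x has_real_derivative v t) (at t)"
    "\<And>t. (v has_real_derivative F (x t)) (at t)"
proof -
  \<comment> \<open>Any rate with K / l^2 at most 1 / 2 would do; this one works because 2 K is at
    most (K + 1)^2.\<close>
  define l where "l = max K 0 + 1"
  have l: "l > 0" "K / (l * l) \<le> 1 / 2"
  proof -
    show "l > 0" by (simp add: l_def)
    have "2 * K \<le> l * l"
      using sum_squares_bound[of "max K 0" 1] unfolding l_def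
      by (simp add: power2_eq_square algebra_simps)
    then show "K / (l * l) \<le> 1 / 2" using \<open>l > 0\<close> by (simp add: field_simps)
  qed
  have K0: "0 \<le> K" using K[of 1 0] by simp
  have F_cont: "continuous_on UNIV F"
    by (rule lipschitz_on_continuous_on[of K]) (use K K0 in \<open>auto simp: lipschitz_on_def dist_real_def\<close>)
  \<comment> \<open>The unknown \<open>b\<close> is the weighted acceleration; \<open>acc\<close>,
    \<open>vel\<close> and \<open>pos\<close> undo the weight and integrate twice.\<close>
  define acc where "acc b t = exp (l * \<bar>t\<bar>) * apply_bcontfun b t" for b :: "real \<Rightarrow>\<^sub>C real" and t
  have acc_cont: "continuous_on UNIV (acc b)" for b
    unfolding acc_def[abs_def] by (intro continuous_intros) auto
  define vel where "vel b = antideriv (acc b)" for b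
  define pos where "pos b = antideriv (vel b)" for b
  have vel_cont: "continuous_on UNIV (vel b)" for b
    unfolding vel_def by (rule continuous_on_antideriv[OF acc_cont])
  have vel: "vel b 0 = 0" "(vel b has_real_derivative acc b t) (at t)" for b t
    unfolding vel_def using antideriv[OF acc_cont] by auto
  have pos: "pos b 0 = 0" "(pos b has_real_derivative vel b t) (at t)" for b t
    unfolding pos_def using antideriv[OF vel_cont] by auto
  have pos_cont: "continuous_on UNIV (pos b)" for b
    unfolding pos_def by (rule continuous_on_antideriv[OF vel_cont])
  \<comment> \<open>Each of the two integrations gains a factor 1 / l against the weight.\<close>
  have diff: "\<bar>pos b t - pos c t\<bar> \<le> dist b c / (l * l) * exp (l * \<bar>t\<bar>)" for b c t
  proof -
    have 1: "\<bar>acc b t - acc c t\<bar> \<le> dist b c * exp (l * \<bar>t\<bar>)" for t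
    proof -
      have "\<bar>acc b t - acc c t\<bar> = exp (l * \<bar>t\<bar>) * dist (apply_bcontfun b t) (apply_bcontfun c t)"
        by (simp add: acc_def dist_real_def abs_mult flip: right_diff_distrib)
      also have "\<dots> \<le> exp (l * \<bar>t\<bar>) * dist b c"
        by (intro mult_left_mono dist_bounded) simp
      finally show ?thesis by (simp add: mult.commute)
    qed
    have 2: "\<bar>vel b t - vel c t\<bar> \<le> dist b c / l * exp (l * \<bar>t\<bar>)" for t
      by (rule exp_growth_bound[where G = "\<lambda>t. vel b t - vel c t", OF l(1) zero_le_dist _ _ 1])
        (use vel in \<open>auto intro: DERIV_diff\<close>)
    have "\<bar>pos b t - pos c t\<bar> \<le> dist b c / l / l * exp (l * \<bar>t\<bar>)" for t
      by (rule exp_growth_bound[where G = "\<lambda>t. pos b t - pos c t", OF l(1) _ _ _ 2])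
        (use l pos in \<open>auto intro: DERIV_diff\<close>)
    then show ?thesis by simp
  qed
  \<comment> \<open>The Picard map: the weighted acceleration that the equation prescribes along the
    curve determined by \<open>b\<close>. The weight is at most 1, so \<open>P b\<close> is bounded
    like \<open>F\<close>.\<close>
  define P where "P b t = exp (- l * \<bar>t\<bar>) * F (x0 + v0 * t + pos b t)" for b t
  have "P b \<in> bcontfun" for b
  proof (rule bcontfun_normI)
    show "continuous_on UNIV (P b)"
      unfolding P_def[abs_def]
      by (intro continuous_intros continuous_on_compose2[OF F_cont] pos_cont) auto
    show "norm (P b t) \<le> 1 * M" for t
      unfolding P_def real_norm_def abs_mult
      by (intro mult_mono M) (use l in auto)
  qed
  then have P: "apply_bcontfun (Bcontfun (P b)) = P b" for b
    by (simp add: Bcontfun_inverse)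
  have "\<exists>!b. Bcontfun (P b) = b"
  proof (rule banach_fix_type[of "1 / 2"])
    show "\<forall>b c. dist (Bcontfun (P b)) (Bcontfun (P c)) \<le> 1 / 2 * dist b c"
    proof (intro allI dist_bound)
      fix b c t
      have "\<bar>P b t - P c t\<bar> = exp (- l * \<bar>t\<bar>) * \<bar>F (x0 + v0 * t + pos b t) - F (x0 + v0 * t + pos c t)\<bar>"
        by (simp add: P_def abs_mult flip: right_diff_distrib)
      also have "\<dots> \<le> exp (- l * \<bar>t\<bar>) * (K * \<bar>pos b t - pos c t\<bar>)"
        using K[of "x0 + v0 * t + pos b t" "x0 + v0 * t + pos c t"] by (intro mult_left_mono) auto
      also have "\<dots> \<le> exp (- l * \<bar>t\<bar>) * (K * (dist b c / (l * l) * exp (l * \<bar>t\<bar>)))"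
        by (intro mult_left_mono diff K0) auto
      also have "\<dots> = K / (l * l) * dist b c"
        by (simp add: exp_minus)
      also have "\<dots> \<le> 1 / 2 * dist b c"
        by (intro mult_right_mono l) auto
      finally show "dist (apply_bcontfun (Bcontfun (P b)) t) (apply_bcontfun (Bcontfun (P c)) t) \<le> 1 / 2 * dist b c"
        by (simp add: P dist_real_def)
    qed
  qed auto
  then obtain b where "Bcontfun (P b) = b" by blast
  then have b: "apply_bcontfun b = P b" using P[of b] by simp
  \<comment> \<open>At the fixed point the weights cancel, which leaves the differential
    equation.\<close>
  have "acc b t = F (x0 + v0 * t + pos b t)" for t
    unfolding acc_def b P_def by (simp add: exp_minus)
  then show ?thesis
    by (intro that[of "\<lambda>t. x0 + v0 * t + pos b t" "\<lambda>t. v0 + vel b t"])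
      (use vel[of b] pos[of b] in \<open>auto intro!: derivative_eq_intros\<close>)
qed

section \<open>Warped product metrics on the plane\<close>

definition diag2 :: "real \<Rightarrow> real \<Rightarrow> real^2^2" where
  "diag2 a b = (\<chi> i j. if i = j then (if i = 1 then a else b) else 0)"

lemma diag2_nth [simp]:
  "diag2 a b $ 1 $ 1 = a" "diag2 a b $ 1 $ 2 = 0" "diag2 a b $ 2 $ 1 = 0" "diag2 a b $ 2 $ 2 = b"
  by (simp_all add: diag2_def)

lemma diag2_mult: "diag2 a b ** diag2 c d = diag2 (a * c) (b * d)"
  by (simp add: vec_eq_iff forall_2 matrix_matrix_mult_def sum_2)

lemma diag2_1: "diag2 1 1 = mat 1"
  by (simp add: vec_eq_iff forall_2 mat_def)

lemma matrix_inv_unique: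
  fixes A B :: "real^'n^'n"
  assumes "A ** B = mat 1" "B ** A = mat 1"
  shows "matrix_inv A = B"
  unfolding matrix_inv_def
proof (rule some_equality)
  fix C assume C: "A ** C = mat 1 \<and> C ** A = mat 1"
  have "C = C ** (A ** B)" using assms by simp
  also have "\<dots> = B" using C by (simp add: matrix_mul_assoc)
  finally show "C = B" .
qed (use assms in simp)

lemma matrix_inv_diag2:
  assumes "a \<noteq> 0" "b \<noteq> 0"
  shows "matrix_inv (diag2 a b) = diag2 (1 / a) (1 / b)"
  using assms by (intro matrix_inv_unique) (simp_all add: diag2_mult diag2_1)

text \<open>Metric components, Christoffel symbols and the test functions all have separated
  variables, so this rule yields every partial derivative below.\<close>

lemma partial_deriv_product:
  fixes p :: "real^2"
  assumes "(\<phi> has_real_derivative \<phi>') (at (p $ 1))" "(\<psi> has_real_derivative \<psi>') (at (p $ 2))"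
  shows "partial_deriv 1 (\<lambda>x. \<phi> (x $ 1) * \<psi> (x $ 2)) p = \<phi>' * \<psi> (p $ 2)"
    and "partial_deriv 2 (\<lambda>x. \<phi> (x $ 1) * \<psi> (x $ 2)) p = \<phi> (p $ 1) * \<psi>'"
proof -
  have 1: "((\<lambda>x::real^2. \<phi> (x $ 1)) has_derivative (\<lambda>h. \<phi>' * h $ 1)) (at p)"
    using has_derivative_compose[OF bounded_linear_imp_has_derivative[OF bounded_linear_vec_nth]]
      assms(1) unfolding has_field_derivative_def by blast
  have 2: "((\<lambda>x::real^2. \<psi> (x $ 2)) has_derivative (\<lambda>h. \<psi>' * h $ 2)) (at p)"
    using has_derivative_compose[OF bounded_linear_imp_has_derivative[OF bounded_linear_vec_nth]]
      assms(2) unfolding has_field_derivative_def by blast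
  have "frechet_derivative (\<lambda>x. \<phi> (x $ 1) * \<psi> (x $ 2)) (at p)
      = (\<lambda>h. \<phi> (p $ 1) * (\<psi>' * h $ 2) + \<phi>' * h $ 1 * \<psi> (p $ 2))"
    using frechet_derivative_at[OF has_derivative_mult[OF 1 2]] by simp
  then show "partial_deriv 1 (\<lambda>x. \<phi> (x $ 1) * \<psi> (x $ 2)) p = \<phi>' * \<psi> (p $ 2)"
    "partial_deriv 2 (\<lambda>x. \<phi> (x $ 1) * \<psi> (x $ 2)) p = \<phi> (p $ 1) * \<psi>'"
    by (simp_all add: partial_deriv_def axis_def)
qed

lemma partial_deriv_first_coord:
  fixes p :: "real^2"
  assumes "(\<phi> has_real_derivative \<phi>') (at (p $ 1))"
  shows "partial_deriv 1 (\<lambda>x. \<phi> (x $ 1)) p = \<phi>'"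
    and "partial_deriv 2 (\<lambda>x. \<phi> (x $ 1)) p = 0"
  using partial_deriv_product[OF assms, of "\<lambda>_. 1" 0] by simp_all

lemma partial_deriv_const:
  fixes p :: "real^2"
  shows "partial_deriv i (\<lambda>x. c :: real) p = 0"
  by (simp add: partial_deriv_def)

text \<open>A single global chart: the only transition map is the identity, and the metric may
  ignore its chart argument.\<close>

definition warped_plane :: "(real \<Rightarrow> real) \<Rightarrow> (real^2, 2) riem_mfd" where
  "warped_plane f = \<lparr>mtop = euclidean, atlas = {(UNIV, id)},
     metric = \<lambda>c p. diag2 1 ((f (p $ 1))\<^sup>2)\<rparr>"

abbreviation std_chart :: "(real^2, 2) chart" where
  "std_chart \<equiv> (UNIV, id)"

lemma warped_plane_simps [simp]:
  "mtop (warped_plane f) = euclidean"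
  "atlas (warped_plane f) = {std_chart}"
  "metric (warped_plane f) c p = diag2 1 ((f (p $ 1))\<^sup>2)"
  by (simp_all add: warped_plane_def)

lemma chart_image_std [simp]: "chart_image std_chart = UNIV"
  by (simp add: chart_image_def)

lemma chart_inv_std [simp]: "chart_inv std_chart = id"
  by (simp add: chart_inv_def fun_eq_iff)

lemma chart_at_warped_plane [simp]: "chart_at (warped_plane f) p = std_chart"
  unfolding chart_at_def by (rule some_equality) auto

lemma local_metric_warped_plane [simp]:
  "local_metric (warped_plane f) std_chart x = diag2 1 ((f (x $ 1))\<^sup>2)"
  by (simp add: local_metric_def)

lemma second_countable_euclidean: "second_countable (euclidean :: 'a::second_countable_topology topology)"
proof -
  obtain B :: "'a set set" where B: "countable B" "topological_basis B"
    using ex_countable_basis by blast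
  then show ?thesis
    unfolding second_countable_def
    by (intro exI[of _ B] conjI)
      (auto simp: topological_basis_open elim!: topological_basisE)
qed

locale warped =
  fixes f f1 f2 :: "real \<Rightarrow> real"
  assumes f_pos: "f x > 0"
    and f_deriv: "(f has_real_derivative f1 x) (at x)"
    and f1_deriv: "(f1 has_real_derivative f2 x) (at x)"
    and f_smooth: "C_k_on k UNIV f"
begin

abbreviation "N \<equiv> warped_plane f"

lemma f_nz [simp]: "f x \<noteq> 0"
  using f_pos[of x] by simp

lemma C_k_on_coord: "C_k_on k UNIV (\<lambda>x::real^2. x $ i)"
  by (rule C_k_on_bounded_linear[OF bounded_linear_vec_nth])

lemma smooth_manifold_warped_plane: "smooth_manifold (mtop N) (atlas N)"
proof -
  have "smooth_on UNIV (id :: real^2 \<Rightarrow> real^2)"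
    unfolding smooth_on_def id_def using C_k_on_bounded_linear[OF bounded_linear_ident] by blast
  moreover have "homeomorphic_map (top_of_set UNIV) (top_of_set UNIV) (id :: real^2 \<Rightarrow> real^2)"
    by (simp add: homeomorphic_map_id)
  ultimately show ?thesis
    unfolding smooth_manifold_def by (simp add: second_countable_euclidean)
qed

lemma riemannian_manifold_warped_plane: "riemannian_manifold N"
proof -
  have "smooth_on UNIV (local_metric N std_chart)"
  proof -
    \<comment> \<open>As a constant plus a scalar function times a fixed matrix, the metric falls
      under the closure rules for \<open>C_k_on\<close>.\<close>
    have "local_metric N std_chart = (\<lambda>x. diag2 1 0 + (f (x $ 1) * f (x $ 1)) *\<^sub>R diag2 0 1)"
      by (simp add: fun_eq_iff vec_eq_iff forall_2 power2_eq_square)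
    moreover have "C_k_on k UNIV (\<lambda>x::real^2. diag2 1 0 + (f (x $ 1) * f (x $ 1)) *\<^sub>R diag2 0 1)" for k
      by (intro C_k_on_add C_k_on_const C_k_on_linear_compose[OF bounded_linear_scaleR_left]
          C_k_on_mult C_k_on_compose[OF f_smooth C_k_on_coord])
    ultimately show ?thesis unfolding smooth_on_def by simp
  qed
  moreover have "v \<bullet> (diag2 1 ((f x)\<^sup>2) *v v) > 0" if "v \<noteq> 0" for x and v :: "real^2"
  proof -
    have "v \<bullet> (diag2 1 ((f x)\<^sup>2) *v v) = (v $ 1)\<^sup>2 + (f x * v $ 2)\<^sup>2"
      by (simp add: inner_vec_def matrix_vector_mult_def sum_2 power2_eq_square algebra_simps)
    also have "\<dots> > 0"
      using that by (auto simp: vec_eq_iff forall_2 sum_power2_gt_zero_iff)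
    finally show ?thesis .
  qed
  moreover have "transpose (diag2 a b) = diag2 a b" for a b
    by (simp add: vec_eq_iff forall_2 transpose_def)
  moreover have "matrix (frechet_derivative (id :: real^2 \<Rightarrow> real^2) (at x)) = mat 1" for x
    by (simp add: id_def flip: matrix_id_mat_1)
  ultimately show ?thesis
    unfolding riemannian_manifold_def using smooth_manifold_warped_plane
    by (simp add: transpose_mat)
qed

section \<open>Connection, curvature and geodesics\<close>

lemma inv_metric_warped_plane [simp]: "inv_metric N std_chart x = diag2 1 (1 / (f (x $ 1))\<^sup>2)"
  by (simp add: inv_metric_def matrix_inv_diag2)

lemma christoffel_warped_plane [simp]:
  "christoffel N std_chart 1 1 1 = (\<lambda>x. 0)"
  "christoffel N std_chart 1 1 2 = (\<lambda>x. 0)"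
  "christoffel N std_chart 1 2 1 = (\<lambda>x. 0)"
  "christoffel N std_chart 1 2 2 = (\<lambda>x. - f (x $ 1) * f1 (x $ 1))"
  "christoffel N std_chart 2 1 1 = (\<lambda>x. 0)"
  "christoffel N std_chart 2 1 2 = (\<lambda>x. f1 (x $ 1) / f (x $ 1))"
  "christoffel N std_chart 2 2 1 = (\<lambda>x. f1 (x $ 1) / f (x $ 1))"
  "christoffel N std_chart 2 2 2 = (\<lambda>x. 0)"
proof -
  have d: "((\<lambda>t. f t * f t) has_real_derivative 2 * f t * f1 t) (at t)" for t
    by (auto intro!: derivative_eq_intros f_deriv)
  note pd = partial_deriv_first_coord[where \<phi> = "\<lambda>t. f t * f t", OF d] partial_deriv_const
  show "christoffel N std_chart 1 1 1 = (\<lambda>x. 0)"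
    "christoffel N std_chart 1 1 2 = (\<lambda>x. 0)"
    "christoffel N std_chart 1 2 1 = (\<lambda>x. 0)"
    "christoffel N std_chart 1 2 2 = (\<lambda>x. - f (x $ 1) * f1 (x $ 1))"
    "christoffel N std_chart 2 1 1 = (\<lambda>x. 0)"
    "christoffel N std_chart 2 1 2 = (\<lambda>x. f1 (x $ 1) / f (x $ 1))"
    "christoffel N std_chart 2 2 1 = (\<lambda>x. f1 (x $ 1) / f (x $ 1))"
    "christoffel N std_chart 2 2 2 = (\<lambda>x. 0)"
    by (auto simp: fun_eq_iff christoffel_def sum_2 pd power2_eq_square)
qed

lemma gaussian_curvature_warped_plane: "gaussian_curvature N p = - f2 (p $ 1) / f (p $ 1)"
proof -
  have 1: "((\<lambda>t. - (f t * f1 t)) has_real_derivative - f1 t * f1 t - f t * f2 t) (at t)" for t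
    by (auto intro!: derivative_eq_intros f_deriv f1_deriv)
  note pd = partial_deriv_first_coord[where \<phi> = "\<lambda>t. - (f t * f1 t)", OF 1] partial_deriv_const
  \<comment> \<open>The two terms \<open>f1\<close> squared cancel: one comes from differentiating -
    f f', the other from the quadratic part. As the metric is diagonal, no other component enters
    the curvature.\<close>
  have "riemann N std_chart 1 1 2 2 p = - f (p $ 1) * f2 (p $ 1)"
    by (simp add: riemann_def sum_2 pd)
  then show ?thesis
    by (simp add: gaussian_curvature_def sum_2 det_2 power2_eq_square)
qed

text \<open>The Clairaut constant \<open>L = f\<^sup>2 y'\<close> of a geodesic \<open>(x, y)\<close> decouples its first component.\<close>

lemma geodesically_complete_warped_plane:
  assumes "\<And>x. \<bar>f1 x / f x ^ 3\<bar> \<le> M"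
    and "\<And>x y. \<bar>f1 x / f x ^ 3 - f1 y / f y ^ 3\<bar> \<le> K * \<bar>x - y\<bar>"
  shows "geodesically_complete N"
  unfolding geodesically_complete_def
proof (intro ballI allI)
  fix c :: "(real^2, 2) chart" and p v :: "real^2"
  assume "c \<in> atlas N" "p \<in> fst c"
  then have c: "c = std_chart" by simp
  \<comment> \<open>The Clairaut constant, read off from the initial data. Inserting y' = L / f^2
    into x'' = f f' y'^2 gives the right-hand side \<open>F\<close>.\<close>
  define L where "L = v $ 2 * (f (p $ 1))\<^sup>2"
  define F where "F x = L\<^sup>2 * (f1 x / f x ^ 3)" for x
  have F1: "\<bar>F x\<bar> \<le> L\<^sup>2 * M" for x
    unfolding F_def abs_mult using mult_left_mono[OF assms(1)[of x], of "L\<^sup>2"] by simp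
  have F2: "\<bar>F x - F y\<bar> \<le> (L\<^sup>2 * K) * \<bar>x - y\<bar>" for x y
    using mult_left_mono[OF assms(2)[of x y], of "L\<^sup>2"]
    unfolding F_def right_diff_distrib[symmetric] abs_mult by (simp add: mult.assoc)
  obtain x w where x0: "x 0 = p $ 1" and w0: "w 0 = v $ 1"
    and x: "\<And>t. (x has_real_derivative w t) (at t)"
    and w: "\<And>t. (w has_real_derivative F (x t)) (at t)"
    using second_order_ode_global[of F, OF F1 F2] by blast
  \<comment> \<open>The velocity y', forced by the conservation of \<open>L\<close>; one more
    integration recovers y.\<close>
  define z where "z t = L / (f (x t))\<^sup>2" for t
  have z: "(z has_real_derivative - 2 * (f1 (x t) / f (x t)) * w t * z t) (at t)" for t
    unfolding z_def[abs_def]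
    by (auto intro!: derivative_eq_intros DERIV_chain2[OF f_deriv x]
        simp: field_simps power2_eq_square)
  have "continuous_on UNIV z"
    using z DERIV_isCont by (blast intro: continuous_at_imp_continuous_on)
  note y = antideriv_0[OF this] antideriv_has_derivative[OF this]
  define \<gamma> where "\<gamma> t = x t *\<^sub>R axis 1 1 + (p $ 2 + antideriv z t) *\<^sub>R (axis 2 1 :: real^2)" for t
  define \<gamma>' where "\<gamma>' t = w t *\<^sub>R axis 1 1 + z t *\<^sub>R (axis 2 1 :: real^2)" for t
  have D: "(\<gamma> has_vector_derivative \<gamma>' t) (at t)" for t
    unfolding \<gamma>_def[abs_def] \<gamma>'_def using x[of t] y(2)[of t]
    by (auto intro!: derivative_eq_intros)
  have D': "(\<gamma>' has_vector_derivative
      F (x t) *\<^sub>R axis 1 1 + (- 2 * (f1 (x t) / f (x t)) * w t * z t) *\<^sub>R axis 2 1) (at t)" for t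
    unfolding \<gamma>'_def[abs_def] using w[of t] z[of t]
    by (auto intro!: derivative_eq_intros)
  have vd: "vector_derivative \<gamma> (at t) = \<gamma>' t" for t
    by (rule vector_derivative_at[OF D])
  have \<gamma>1: "\<gamma> t $ 1 = x t" for t
    by (simp add: \<gamma>_def axis_def)
  have \<gamma>': "\<gamma>' t $ 1 = w t" "\<gamma>' t $ 2 = z t" for t
    by (simp_all add: \<gamma>'_def axis_def)
  \<comment> \<open>These are the geodesic equations x'' = f f' y'^2 and y'' = - 2 (f' / f) x'
    y'.\<close>
  have acc: "F (x t) *\<^sub>R axis 1 1 + (- 2 * (f1 (x t) / f (x t)) * w t * z t) *\<^sub>R axis 2 1
      = (\<chi> k. - (\<Sum>i\<in>UNIV. \<Sum>j\<in>UNIV. christoffel N std_chart k i j (\<gamma> t) * \<gamma>' t $ i * \<gamma>' t $ j))" for t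
    by (simp add: vec_eq_iff forall_2 sum_2 \<gamma>1 \<gamma>' axis_def)
      (simp add: F_def z_def field_simps power2_eq_square power3_eq_cube)
  have "continuous_on UNIV \<gamma>"
    using D has_vector_derivative_continuous by (blast intro: continuous_at_imp_continuous_on)
  then have "geodesic_on N UNIV \<gamma>"
    unfolding geodesic_on_def using D D'
    by (auto simp: vd intro: differentiableI_vector simp flip: acc)
  moreover have "\<gamma> 0 = p"
    by (simp add: vec_eq_iff forall_2 \<gamma>_def axis_def x0 y)
  moreover have "\<gamma>' 0 = v"
    by (simp add: vec_eq_iff forall_2 \<gamma>'_def axis_def w0 z_def x0 L_def)
  ultimately show "\<exists>\<gamma>. geodesic_on N UNIV \<gamma> \<and> \<gamma> 0 = p \<and> vector_derivative (snd c \<circ> \<gamma>) (at 0) = v"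
    by (intro exI[of _ \<gamma>]) (simp add: c vd)
qed

section \<open>Volume measure and norms\<close>

lemma f_measurable [measurable]: "f \<in> borel_measurable borel"
  using f_deriv DERIV_isCont
  by (blast intro: borel_measurable_continuous_onI continuous_at_imp_continuous_on)

text \<open>The chart covers the whole plane, so the chart condition already prescribes the measure
  of every Borel set; this gives uniqueness.\<close>

lemma riemannian_volume_warped_plane:
  "riemannian_volume N = density lborel (\<lambda>x. ennreal (f (x $ 1)))"
  unfolding riemannian_volume_def
proof (rule the_equality)
  have det: "sqrt (det (local_metric N std_chart x)) = f (x $ 1)" for x
    using f_pos[of "x $ 1"] by (simp add: det_2)
  have S: "sets (sigma (topspace (mtop N)) {U. openin (mtop N) U}) = sets borel"
    by (simp add: borel_def)
  show V: "is_riemannian_volume N (density lborel (\<lambda>x. ennreal (f (x $ 1))))"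
    unfolding is_riemannian_volume_def S
    by (simp add: det emeasure_density del: local_metric_warped_plane)
  show "\<mu> = density lborel (\<lambda>x. ennreal (f (x $ 1)))" if "is_riemannian_volume N \<mu>" for \<mu>
  proof (rule measure_eqI)
    show s: "sets \<mu> = sets (density lborel (\<lambda>x. ennreal (f (x $ 1))))"
      using that V unfolding is_riemannian_volume_def by blast
    show "emeasure \<mu> A = emeasure (density lborel (\<lambda>x. ennreal (f (x $ 1)))) A" if "A \<in> sets \<mu>" for A
      using \<open>is_riemannian_volume N \<mu>\<close> V that s unfolding is_riemannian_volume_def by auto
  qed
qed

text \<open>Measurability is asked of the square, since for the Hessian norm it is the square whose
  continuity is at hand.\<close>

lemma L2_norm_warped_plane:
  assumes "(\<lambda>x. (\<phi> x)\<^sup>2) \<in> borel_measurable borel"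
  shows "L2_norm N \<phi> = sqrt (\<integral>x. f (x $ 1) * (\<phi> x)\<^sup>2 \<partial>lborel)"
  unfolding L2_norm_def riemannian_volume_warped_plane
  using assms f_pos by (subst integral_density) (auto intro!: AE_I2 less_imp_le)

section \<open>Hessian and Laplacian of functions with separated variables\<close>

context
  fixes \<phi> \<phi>1 \<phi>2 \<psi> \<psi>1 \<psi>2 :: "real \<Rightarrow> real"
  assumes \<phi>: "\<And>t. (\<phi> has_real_derivative \<phi>1 t) (at t)" "\<And>t. (\<phi>1 has_real_derivative \<phi>2 t) (at t)"
    and \<psi>: "\<And>t. (\<psi> has_real_derivative \<psi>1 t) (at t)" "\<And>t. (\<psi>1 has_real_derivative \<psi>2 t) (at t)"
begin

lemma hess_product:
  fixes x :: "real^2"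
  defines "H \<equiv> hess N std_chart (\<lambda>x. \<phi> (x $ 1) * \<psi> (x $ 2)) x" and "s \<equiv> x $ 1" and "t \<equiv> x $ 2"
  shows "H $ 1 $ 1 = \<phi>2 s * \<psi> t"
    "H $ 1 $ 2 = \<phi>1 s * \<psi>1 t - f1 s / f s * (\<phi> s * \<psi>1 t)"
    "H $ 2 $ 1 = \<phi>1 s * \<psi>1 t - f1 s / f s * (\<phi> s * \<psi>1 t)"
    "H $ 2 $ 2 = \<phi> s * \<psi>2 t + f s * f1 s * (\<phi>1 s * \<psi> t)"
proof -
  have d: "differential std_chart (\<lambda>x. \<phi> (x $ 1) * \<psi> (x $ 2)) 1 = (\<lambda>x. \<phi>1 (x $ 1) * \<psi> (x $ 2))"
    "differential std_chart (\<lambda>x. \<phi> (x $ 1) * \<psi> (x $ 2)) 2 = (\<lambda>x. \<phi> (x $ 1) * \<psi>1 (x $ 2))"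
    by (simp_all add: fun_eq_iff differential_def partial_deriv_product[OF \<phi>(1) \<psi>(1)])
  note pd = partial_deriv_product[OF \<phi>(2) \<psi>(1)] partial_deriv_product[OF \<phi>(1) \<psi>(2)]
  show "H $ 1 $ 1 = \<phi>2 s * \<psi> t"
    "H $ 1 $ 2 = \<phi>1 s * \<psi>1 t - f1 s / f s * (\<phi> s * \<psi>1 t)"
    "H $ 2 $ 1 = \<phi>1 s * \<psi>1 t - f1 s / f s * (\<phi> s * \<psi>1 t)"
    "H $ 2 $ 2 = \<phi> s * \<psi>2 t + f s * f1 s * (\<phi>1 s * \<psi> t)"
    by (simp_all add: H_def s_def t_def hess_def cov_deriv_form_def sum_2 d pd)
qed

text \<open>In the orthonormal frame each index 2 costs a factor 1 / f, and the mixed component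
  counts twice. A sum of squares results, so any single summand bounds it from below.\<close>

lemma hess_norm_product_square:
  fixes x :: "real^2"
  defines "s \<equiv> x $ 1" and "t \<equiv> x $ 2"
  shows "(hess_norm N (\<lambda>x. \<phi> (x $ 1) * \<psi> (x $ 2)) x)\<^sup>2 = (\<phi>2 s * \<psi> t)\<^sup>2
    + 2 * ((\<phi>1 s * \<psi>1 t - f1 s / f s * (\<phi> s * \<psi>1 t)) / f s)\<^sup>2
    + ((\<phi> s * \<psi>2 t + f s * f1 s * (\<phi>1 s * \<psi> t)) / (f s)\<^sup>2)\<^sup>2" (is "_ = ?R")
proof -
  have "hess_norm N (\<lambda>x. \<phi> (x $ 1) * \<psi> (x $ 2)) x = sqrt ?R"
    unfolding hess_norm_def Let_def
    by (simp add: sum_2 hess_product s_def t_def power2_eq_square)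
  then show ?thesis
    by simp
qed

lemma laplacian_product:
  fixes x :: "real^2"
  defines "s \<equiv> x $ 1" and "t \<equiv> x $ 2"
  shows "laplacian N (\<lambda>x. \<phi> (x $ 1) * \<psi> (x $ 2)) x
    = - ((\<phi>2 s + f1 s / f s * \<phi>1 s) * \<psi> t + \<phi> s * \<psi>2 t / (f s)\<^sup>2)"
  by (simp add: laplacian_def Let_def sum_2 hess_product s_def t_def field_simps power2_eq_square)

end

end

section \<open>A rapidly oscillating warping function\<close>

definition osc :: "real \<Rightarrow> real" where
  "osc x = (1 + x\<^sup>2) / (2 + sin (x\<^sup>2))"

definition osc1 :: "real \<Rightarrow> real" where
  "osc1 x = 2 * x / (2 + sin (x\<^sup>2)) - (1 + x\<^sup>2) * (2 * x * cos (x\<^sup>2)) / (2 + sin (x\<^sup>2))\<^sup>2"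

definition osc2 :: "real \<Rightarrow> real" where
  "osc2 x = 2 / (2 + sin (x\<^sup>2))
     - (8 * x\<^sup>2 * cos (x\<^sup>2) + (1 + x\<^sup>2) * (2 * cos (x\<^sup>2) - 4 * x\<^sup>2 * sin (x\<^sup>2))) / (2 + sin (x\<^sup>2))\<^sup>2
     + 2 * (1 + x\<^sup>2) * (2 * x * cos (x\<^sup>2))\<^sup>2 / (2 + sin (x\<^sup>2)) ^ 3"

lemma osc_denominator: "1 \<le> 2 + sin (x\<^sup>2)" "2 + sin (x\<^sup>2) \<le> 3" "2 + sin (x\<^sup>2) \<noteq> 0" for x :: real
  using sin_ge_minus_one[of "x\<^sup>2"] sin_le_one[of "x\<^sup>2"] by linarith+

lemma osc_bounds: "(1 + x\<^sup>2) / 3 \<le> osc x" "osc x \<le> 1 + x\<^sup>2" "0 < osc x"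
proof -
  have p: "0 < 1 + x\<^sup>2" by (simp add: add_pos_nonneg)
  show 1: "(1 + x\<^sup>2) / 3 \<le> osc x"
    unfolding osc_def using osc_denominator[of x] p by (intro divide_left_mono) auto
  have "osc x \<le> (1 + x\<^sup>2) / 1"
    unfolding osc_def using osc_denominator[of x] p by (intro divide_left_mono) auto
  then show "osc x \<le> 1 + x\<^sup>2" by simp
  show "0 < osc x" using less_le_trans[OF divide_pos_pos[OF p] 1] by simp
qed

lemma osc_has_derivative: "(osc has_real_derivative osc1 x) (at x)"
proof -
  have "((\<lambda>x. 1 + x\<^sup>2) has_real_derivative 2 * x) (at x)"
    "((\<lambda>x. 2 + sin (x\<^sup>2)) has_real_derivative 2 * x * cos (x\<^sup>2)) (at x)"
    by (auto intro!: derivative_eq_intros)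
  from DERIV_divide[OF this osc_denominator(3)] show ?thesis
    unfolding osc_def[abs_def] osc1_def using osc_denominator(3)[of x]
    by (simp add: diff_divide_distrib power2_eq_square)
qed

lemma osc1_has_derivative: "(osc1 has_real_derivative osc2 x) (at x)"
proof -
  define d where "d = 2 + sin (x\<^sup>2)"
  have d: "d \<noteq> 0" using osc_denominator[of x] by (simp add: d_def)
  have D: "((\<lambda>x. 2 + sin (x\<^sup>2)) has_real_derivative 2 * x * cos (x\<^sup>2)) (at x)"
    by (auto intro!: derivative_eq_intros)
  have 1: "((\<lambda>x. 2 * x / (2 + sin (x\<^sup>2))) has_real_derivative
      (2 * d - 2 * x * (2 * x * cos (x\<^sup>2))) / (d * d)) (at x)"
    using DERIV_divide[OF DERIV_cmult_Id D osc_denominator(3), of 2] unfolding d_def .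
  have 2: "((\<lambda>x. (1 + x\<^sup>2) * (2 * x * cos (x\<^sup>2))) has_real_derivative
      4 * x\<^sup>2 * cos (x\<^sup>2) + (1 + x\<^sup>2) * (2 * cos (x\<^sup>2) - 4 * x\<^sup>2 * sin (x\<^sup>2))) (at x)"
    by (auto intro!: derivative_eq_intros simp: algebra_simps power2_eq_square)
  have 3: "((\<lambda>x. (2 + sin (x\<^sup>2))\<^sup>2) has_real_derivative 2 * d * (2 * x * cos (x\<^sup>2))) (at x)"
    unfolding d_def by (auto intro!: derivative_eq_intros)
  have "(osc1 has_real_derivative
      (2 * d - 2 * x * (2 * x * cos (x\<^sup>2))) / (d * d)
      - ((4 * x\<^sup>2 * cos (x\<^sup>2) + (1 + x\<^sup>2) * (2 * cos (x\<^sup>2) - 4 * x\<^sup>2 * sin (x\<^sup>2))) * d\<^sup>2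
        - (1 + x\<^sup>2) * (2 * x * cos (x\<^sup>2)) * (2 * d * (2 * x * cos (x\<^sup>2)))) / (d\<^sup>2 * d\<^sup>2)) (at x)"
    using DERIV_diff[OF 1 DERIV_divide[OF 2 3]] osc_denominator(3)[of x]
    unfolding osc1_def[abs_def] d_def by (metis power_not_zero)
  moreover have "(2 * d - 2 * x * (2 * x * c)) / (d * d)
      - ((4 * x\<^sup>2 * c + (1 + x\<^sup>2) * (2 * c - 4 * x\<^sup>2 * s)) * d\<^sup>2
        - (1 + x\<^sup>2) * (2 * x * c) * (2 * d * (2 * x * c))) / (d\<^sup>2 * d\<^sup>2)
      = 2 / d - (8 * x\<^sup>2 * c + (1 + x\<^sup>2) * (2 * c - 4 * x\<^sup>2 * s)) / d\<^sup>2
        + 2 * (1 + x\<^sup>2) * (2 * x * c)\<^sup>2 / d ^ 3" for c s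
    using d by (simp add: divide_simps) (simp add: eval_nat_numeral algebra_simps)
  ultimately show ?thesis
    unfolding osc2_def d_def by simp
qed

lemma C_k_on_osc: "C_k_on k UNIV osc"
proof -
  have id: "C_k_on k UNIV (\<lambda>x::real. x)"
    by (rule C_k_on_bounded_linear[OF bounded_linear_ident])
  have "2 + sin (x * x) \<noteq> 0" for x :: real
    using osc_denominator(3)[of x] by (simp add: power2_eq_square)
  then have "C_k_on k UNIV (\<lambda>x::real. (1 + x * x) * inverse (2 + sin (x * x)))"
    by (intro C_k_on_mult C_k_on_add C_k_on_const C_k_on_inverse C_k_on_compose[OF C_k_on_sin] id)
  then show ?thesis
    by (simp add: osc_def[abs_def] power2_eq_square divide_inverse)
qed

interpretation osc: warped osc osc1 osc2
  by unfold_locales (rule osc_bounds osc_has_derivative osc1_has_derivative C_k_on_osc)+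

section \<open>Growth bounds, completeness and curvature\<close>

lemma abs_div_osc_denominator_le:
  "\<bar>a / (2 + sin (x\<^sup>2))\<bar> \<le> \<bar>a\<bar>" "\<bar>a / (2 + sin (x\<^sup>2)) ^ n\<bar> \<le> \<bar>a\<bar>" for a x :: real
proof -
  have *: "\<bar>a / d\<bar> \<le> \<bar>a\<bar>" if "1 \<le> d" for d :: real
    using that mult_left_mono[OF that, of "\<bar>a\<bar>"] by (simp add: abs_divide divide_le_eq)
  show "\<bar>a / (2 + sin (x\<^sup>2))\<bar> \<le> \<bar>a\<bar>" "\<bar>a / (2 + sin (x\<^sup>2)) ^ n\<bar> \<le> \<bar>a\<bar>"
    using osc_denominator(1)[of x] by (intro * one_le_power; assumption)+
qed

lemma abs_le_1_plus_square: "\<bar>x\<bar> \<le> 1 + x\<^sup>2" "2 * \<bar>x\<bar> \<le> 1 + x\<^sup>2" for x :: real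
proof -
  show 2: "2 * \<bar>x\<bar> \<le> 1 + x\<^sup>2"
    using sum_squares_bound[of 1 "\<bar>x\<bar>"] by simp
  then show "\<bar>x\<bar> \<le> 1 + x\<^sup>2" by simp
qed

lemma osc1_bound: "\<bar>osc1 x\<bar> \<le> 2 * (1 + x\<^sup>2)\<^sup>2"
proof -
  let ?w = "1 + x\<^sup>2"
  have w: "1 \<le> ?w" by simp
  have "\<bar>osc1 x\<bar> \<le> \<bar>2 * x\<bar> + \<bar>?w * (2 * x * cos (x\<^sup>2))\<bar>"
    unfolding osc1_def
    by (rule abs_triangle_ineq4[THEN order_trans])
      (intro add_mono abs_div_osc_denominator_le)
  also have "\<bar>2 * x\<bar> \<le> ?w" using abs_le_1_plus_square(2)[of x] by simp
  also have "\<bar>?w * (2 * x * cos (x\<^sup>2))\<bar> \<le> ?w * (?w * 1)"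
    unfolding abs_mult using abs_le_1_plus_square(2)[of x]
    by (intro mult_mono) (auto simp: abs_mult)
  also have "?w + ?w * (?w * 1) \<le> 2 * ?w\<^sup>2"
    using mult_mono[OF w order_refl, of ?w] w by (simp add: power2_eq_square)
  finally show ?thesis by simp
qed

lemma osc2_bound: "\<bar>osc2 x\<bar> \<le> 18 * (1 + x\<^sup>2) ^ 3"
proof -
  let ?w = "1 + x\<^sup>2" and ?c = "cos (x\<^sup>2)" and ?s = "sin (x\<^sup>2)"
  have w: "1 \<le> ?w" by simp
  have cs: "\<bar>?c\<bar> \<le> 1" "\<bar>?s\<bar> \<le> 1" by auto
  have x2: "x\<^sup>2 \<le> ?w" by simp
  have "\<bar>osc2 x\<bar> \<le> \<bar>2\<bar> + \<bar>8 * x\<^sup>2 * ?c + ?w * (2 * ?c - 4 * x\<^sup>2 * ?s)\<bar> + \<bar>2 * ?w * (2 * x * ?c)\<^sup>2\<bar>"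
    unfolding osc2_def
    by (rule abs_triangle_ineq[THEN order_trans], intro add_mono abs_triangle_ineq4[THEN order_trans]
        abs_div_osc_denominator_le)
  also have "\<bar>8 * x\<^sup>2 * ?c + ?w * (2 * ?c - 4 * x\<^sup>2 * ?s)\<bar> \<le> 8 * ?w + ?w * (2 + 4 * ?w)"
  proof -
    have "\<bar>8 * x\<^sup>2 * ?c\<bar> \<le> 8 * ?w * 1"
      unfolding abs_mult by (intro mult_mono) (use x2 cs in auto)
    moreover have "\<bar>2 * ?c - 4 * x\<^sup>2 * ?s\<bar> \<le> 2 + 4 * ?w"
    proof -
      have "\<bar>4 * x\<^sup>2 * ?s\<bar> \<le> 4 * ?w * 1"
        unfolding abs_mult by (intro mult_mono) (use x2 cs in auto)
      then show ?thesis using cs by linarith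
    qed
    then have "\<bar>?w * (2 * ?c - 4 * x\<^sup>2 * ?s)\<bar> \<le> ?w * (2 + 4 * ?w)"
      unfolding abs_mult by (intro mult_mono) auto
    ultimately show ?thesis by linarith
  qed
  also have "\<bar>2 * ?w * (2 * x * ?c)\<^sup>2\<bar> \<le> 2 * ?w * ?w\<^sup>2"
  proof -
    have "\<bar>2 * x * ?c\<bar> \<le> ?w * 1"
      unfolding abs_mult using abs_le_1_plus_square(2)[of x] cs by (intro mult_mono) auto
    then have "(2 * x * ?c)\<^sup>2 \<le> ?w\<^sup>2"
      using abs_le_square_iff[of "2 * x * ?c" ?w] w by simp
    then have "2 * ?w * (2 * x * ?c)\<^sup>2 \<le> 2 * ?w * ?w\<^sup>2"
      by (intro mult_left_mono) auto
    then show ?thesis by (simp add: abs_mult)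
  qed
  also have "\<bar>2\<bar> + (8 * ?w + ?w * (2 + 4 * ?w)) + 2 * ?w * ?w\<^sup>2 \<le> 18 * ?w ^ 3"
  proof -
    have "\<bar>2\<bar> + (8 * v + v * (2 + 4 * v)) + 2 * v * v\<^sup>2 \<le> 18 * v ^ 3" if "1 \<le> v" for v :: real
    proof -
      have "1 \<le> v ^ 3" "v ^ 1 \<le> v ^ 3" "v ^ 2 \<le> v ^ 3"
        by (rule one_le_power[OF that], (rule power_increasing[OF _ that], simp)+)
      moreover have "\<bar>2\<bar> + (8 * v + v * (2 + 4 * v)) + 2 * v * v\<^sup>2 = 2 + 10 * v ^ 1 + 4 * v ^ 2 + 2 * v ^ 3"
        by (simp add: algebra_simps power2_eq_square power3_eq_cube)
      ultimately show ?thesis by linarith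
    qed
    then show ?thesis using w .
  qed
  finally show ?thesis by simp
qed

text \<open>Since \<open>osc x\<close> is at least a third of 1 + x^2, its powers absorb the
  polynomial growth of the derivatives.\<close>

lemma divide_osc_power_bound:
  assumes "\<bar>a\<bar> \<le> C * (1 + x\<^sup>2) ^ n"
  shows "\<bar>a / osc x ^ n\<bar> \<le> C * 3 ^ n"
proof -
  have "\<bar>a\<bar> \<le> C * (1 + x\<^sup>2) ^ n" by (rule assms)
  also have "\<dots> = C * 3 ^ n * ((1 + x\<^sup>2) / 3) ^ n" by (simp add: power_divide)
  also have "\<dots> \<le> C * 3 ^ n * osc x ^ n"
  proof (rule mult_left_mono)
    show "((1 + x\<^sup>2) / 3) ^ n \<le> osc x ^ n"
      by (rule power_mono[OF osc_bounds(1)]) simp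
    have "0 \<le> C * (1 + x\<^sup>2) ^ n" using assms abs_ge_zero[of a] by linarith
    then have "0 \<le> C" by (simp add: zero_le_mult_iff add_pos_nonneg not_le)
        (metis add_pos_nonneg less_le_not_le zero_le_power2 zero_less_one zero_less_power)
    then show "0 \<le> C * 3 ^ n" by simp
  qed
  finally show ?thesis
    using osc_bounds(3)[of x] by (simp add: abs_divide abs_mult divide_le_eq)
qed

lemma geodesically_complete_osc: "geodesically_complete (warped_plane osc)"
proof (rule osc.geodesically_complete_warped_plane)
  have w: "1 \<le> 1 + x\<^sup>2" for x :: real by simp
  \<comment> \<open>The exponent 2 is raised to 3 to match the cube in the denominator.\<close>
  have o1: "\<bar>osc1 x\<bar> \<le> 2 * (1 + x\<^sup>2) ^ 3" for x
    by (rule osc1_bound[THEN order_trans]) (use power_increasing[OF _ w, of 2 3] in simp)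
  show "\<bar>osc1 x / osc x ^ 3\<bar> \<le> 2 * 3 ^ 3" for x
    by (rule divide_osc_power_bound[OF o1])
  define F' where "F' x = osc2 x / osc x ^ 3 - 3 * (osc1 x)\<^sup>2 / osc x ^ 4" for x
  have D: "((\<lambda>x. osc1 x / osc x ^ 3) has_real_derivative F' x) (at x)" for x
    unfolding F'_def using osc_bounds(3)[of x]
    by (auto intro!: derivative_eq_intros osc_has_derivative osc1_has_derivative
        simp: field_simps eval_nat_numeral)
  \<comment> \<open>A bound for the derivative becomes the Lipschitz constant through the mean value
    inequality.\<close>
  have B: "norm (F' x) \<le> 18 * 3 ^ 3 + 12 * 3 ^ 4" for x
  proof -
    have "(osc1 x)\<^sup>2 \<le> (2 * (1 + x\<^sup>2)\<^sup>2)\<^sup>2"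
      using power_mono[OF osc1_bound[of x], of 2] by simp
    also have "\<dots> = 4 * (1 + x\<^sup>2) ^ 4" by (simp add: power_mult_distrib flip: power_mult)
    finally have "\<bar>3 * (osc1 x)\<^sup>2\<bar> \<le> 12 * (1 + x\<^sup>2) ^ 4" by simp
    from divide_osc_power_bound[OF this] divide_osc_power_bound[OF osc2_bound, of x]
    show ?thesis unfolding F'_def real_norm_def by linarith
  qed
  show "\<bar>osc1 x / osc x ^ 3 - osc1 y / osc y ^ 3\<bar> \<le> (18 * 3 ^ 3 + 12 * 3 ^ 4) * \<bar>x - y\<bar>" for x y
    using field_differentiable_bound[of UNIV "\<lambda>x. osc1 x / osc x ^ 3" F', OF _ _ B] D by simp
qed

lemma unbounded_curvature_osc: "\<not> bounded (range (gaussian_curvature (warped_plane osc)))"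
proof
  assume "bounded (range (gaussian_curvature (warped_plane osc)))"
  then obtain C where C: "\<And>p. \<bar>gaussian_curvature (warped_plane osc) p\<bar> \<le> C"
    by (auto simp: bounded_iff)
  obtain n :: nat where n: "C < real n" using reals_Archimedean2 by blast
  \<comment> \<open>At such y the sine is 1 and the cosine 0, so the term of \<open>osc2\<close>
    with the sine is as large as possible and those with the cosine vanish.\<close>
  define y where "y = pi / 2 + 2 * real n * pi"
  define x where "x = sqrt y"
  have "real n * 1 \<le> real n * (2 * pi)" "2 * real n * pi = real n * (2 * pi)" using pi_gt3 by (intro mult_left_mono) auto
  then have y: "real n \<le> y" "0 \<le> y" unfolding y_def using pi_gt_zero by linarith+
  have x2: "x\<^sup>2 = y" using y by (simp add: x_def)
  have "sin y = 1" "cos y = 0"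
    unfolding y_def sin_add cos_add cos_2npi sin_2npi by simp_all
  then have "osc2 x / osc x = 2 / (1 + y) + 4 * y / 3"
    using y unfolding osc2_def osc_def x2 by (simp add: field_simps)
  moreover have "0 \<le> 2 / (1 + y)" using y by simp
  ultimately have "real n \<le> \<bar>osc2 x / osc x\<bar>" using y by linarith
  moreover have "\<bar>osc2 x / osc x\<bar> \<le> C"
    using C[of "vec x"] by (simp add: osc.gaussian_curvature_warped_plane)
  ultimately show False using n by linarith
qed

section \<open>Failure of the Calderon-Zygmund inequality\<close>

definition rect :: "real \<Rightarrow> real \<Rightarrow> real \<Rightarrow> real \<Rightarrow> (real^2) set" where
  "rect a b c d = cbox (vector [a, c]) (vector [b, d])"

lemma mem_rect: "x \<in> rect a b c d \<longleftrightarrow> a \<le> x $ 1 \<and> x $ 1 \<le> b \<and> c \<le> x $ 2 \<and> x $ 2 \<le> d"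
  by (auto simp: rect_def mem_box_cart forall_2)

lemma compact_rect: "compact (rect a b c d)"
  by (simp add: rect_def)

lemma rect_measurable [measurable]: "rect a b c d \<in> sets borel"
  by (simp add: rect_def)

lemma measure_rect:
  assumes "a \<le> b" "c \<le> d"
  shows "measure lborel (rect a b c d) = (b - a) * (d - c)"
proof -
  have "vector [a, c] \<in> rect a b c d" using assms by (simp add: mem_rect)
  then have "cbox (vector [a, c]) (vector [b, d] :: real^2) \<noteq> {}" by (auto simp: rect_def)
  then show ?thesis
    by (simp add: rect_def content_cbox_cart UNIV_2)
qed

lemma integrable_indicator_rect: "integrable lborel (\<lambda>x. indicator (rect a b c d) x * (K :: real))"
  by (intro integrable_mult_left integrable_real_indicator rect_measurable[simplified])
    (use emeasure_bounded_finite[OF compact_imp_bounded[OF compact_rect]] in simp_all)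

lemma integral_indicator_rect:
  assumes "a \<le> b" "c \<le> d"
  shows "(\<integral>x. indicator (rect a b c d) x * K \<partial>lborel) = (b - a) * (d - c) * (K :: real)"
  by (simp add: measure_rect[OF assms])

lemma integral_le_rect:
  fixes g :: "real^2 \<Rightarrow> real"
  assumes "a \<le> b" "c \<le> d" "0 \<le> K"
    and "\<And>x. x \<in> rect a b c d \<Longrightarrow> g x \<le> K" "\<And>x. x \<notin> rect a b c d \<Longrightarrow> g x = 0"
  shows "(\<integral>x. g x \<partial>lborel) \<le> (b - a) * (d - c) * K"
proof -
  have "(\<integral>x. g x \<partial>lborel) \<le> (\<integral>x. indicator (rect a b c d) x * K \<partial>lborel)"
    \<comment> \<open>Should \<open>g\<close> not be integrable, its integral is 0 by convention;
      \<open>0 \<le> K\<close> makes the bound true in that case as well.\<close>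
    by (rule integral_mono'[OF integrable_indicator_rect]) (use assms in \<open>auto simp: indicator_def\<close>)
  then show ?thesis unfolding integral_indicator_rect[OF assms(1,2)] .
qed

lemma integral_ge_rect:
  fixes g :: "real^2 \<Rightarrow> real"
  assumes "a \<le> b" "c \<le> d" "integrable lborel g" "\<And>x. 0 \<le> g x"
    and "\<And>x. x \<in> rect a b c d \<Longrightarrow> K \<le> g x"
  shows "(b - a) * (d - c) * K \<le> (\<integral>x. g x \<partial>lborel)"
proof -
  have "(\<integral>x. indicator (rect a b c d) x * K \<partial>lborel) \<le> (\<integral>x. g x \<partial>lborel)"
    by (rule integral_mono'[OF assms(3)]) (use assms in \<open>auto simp: indicator_def\<close>)
  then show ?thesis unfolding integral_indicator_rect[OF assms(1,2)] .
qed

lemma integrable_supported_rect: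
  fixes g :: "real^2 \<Rightarrow> real"
  assumes "continuous_on UNIV g" "\<And>x. x \<notin> rect a b c d \<Longrightarrow> g x = 0"
  shows "integrable lborel g"
proof -
  have "integrable lborel (\<lambda>x. indicator (rect a b c d) x *\<^sub>R g x)"
    by (rule borel_integrable_compact[OF compact_rect continuous_on_subset[OF assms(1)]]) simp
  also have "(\<lambda>x. indicator (rect a b c d) x *\<^sub>R g x) = g"
    using assms(2) by (auto simp: fun_eq_iff indicator_def)
  finally show ?thesis .
qed

section \<open>A cutoff in the conformal coordinate\<close>

lemma continuous_on_osc:
  "continuous_on S osc" "continuous_on S osc1"
  using osc_has_derivative osc1_has_derivative DERIV_isCont
  by (blast intro: continuous_at_imp_continuous_on)+

lemma osc_nz [simp]: "osc x \<noteq> 0"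
  using osc_bounds(3)[of x] by simp

text \<open>The coordinate s with ds = dx / f, in which the metric is f^2 (ds^2 + dy^2).\<close>

definition conf_coord :: "real \<Rightarrow> real" where
  "conf_coord = antideriv (\<lambda>x. 1 / osc x)"

lemma conf_coord_has_derivative: "(conf_coord has_real_derivative 1 / osc x) (at x)"
  unfolding conf_coord_def
  by (rule antideriv_has_derivative) (intro continuous_intros continuous_on_osc; simp)

lemma C_k_on_conf_coord: "C_k_on k UNIV conf_coord"
  by (rule C_k_on_antiderivative[OF conf_coord_has_derivative])
    (use C_k_on_inverse[OF C_k_on_osc] in \<open>simp add: inverse_eq_divide\<close>)

text \<open>The surface is conformal to a flat strip with coordinates \<open>conf_coord x\<close> and \<open>y\<close>, so that the
  Laplacian of a cutoff function of these coordinates involves no derivative of \<open>osc\<close>, while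
  its Hessian does. The constant below is of the order of \<open>osc\<close> near \<open>X\<close>.\<close>

definition cut_scale :: "real \<Rightarrow> real" where
  "cut_scale X = 2 * (1 + (X + 1)\<^sup>2)"

text \<open>The shift places \<open>X\<close> at the argument - 1 / 2, on the rising flank of
  \<open>bump\<close>, where \<open>bump1\<close> is positive.\<close>

definition cut_arg :: "real \<Rightarrow> real \<Rightarrow> real" where
  "cut_arg X x = - 1 / 2 + cut_scale X * (conf_coord x - conf_coord X)"

definition cutoff :: "real \<Rightarrow> real \<Rightarrow> real" where
  "cutoff X x = bump (cut_arg X x)"

definition cutoff1 :: "real \<Rightarrow> real \<Rightarrow> real" where
  "cutoff1 X x = bump1 (cut_arg X x) * (cut_scale X / osc x)"

text \<open>The term with \<open>osc1\<close> is the decisive one: it is large in the Hessian and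
  cancels in the Laplacian.\<close>

definition cutoff2 :: "real \<Rightarrow> real \<Rightarrow> real" where
  "cutoff2 X x = bump2 (cut_arg X x) * (cut_scale X / osc x)\<^sup>2
     - bump1 (cut_arg X x) * (cut_scale X / osc x) * (osc1 x / osc x)"

definition test_fun :: "real \<Rightarrow> real^2 \<Rightarrow> real" where
  "test_fun X p = cutoff X (p $ 1) * bump (p $ 2)"

lemma cut_scale_pos: "0 < cut_scale X"
  by (simp add: cut_scale_def add_pos_nonneg)

lemma cut_arg_has_derivative: "(cut_arg X has_real_derivative cut_scale X / osc x) (at x)"
  unfolding cut_arg_def[abs_def] by (auto intro!: derivative_eq_intros conf_coord_has_derivative)

lemma cutoff_has_derivative: "(cutoff X has_real_derivative cutoff1 X x) (at x)"
  unfolding cutoff_def[abs_def] cutoff1_def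
  by (rule DERIV_chain2[OF bump_has_derivative cut_arg_has_derivative])

lemma cutoff1_has_derivative: "(cutoff1 X has_real_derivative cutoff2 X x) (at x)"
proof -
  have "((\<lambda>x. cut_scale X / osc x) has_real_derivative - (cut_scale X / osc x) * (osc1 x / osc x)) (at x)"
    by (auto intro!: derivative_eq_intros osc_has_derivative simp: field_simps)
  from DERIV_mult[OF DERIV_chain2[OF bump1_has_derivative cut_arg_has_derivative] this]
  show ?thesis
    unfolding cutoff1_def[abs_def] cutoff2_def
    by (rule DERIV_cong) (simp add: power2_eq_square algebra_simps)
qed

lemma continuous_on_cutoff:
  "continuous_on S (cutoff X)" "continuous_on S (cutoff1 X)" "continuous_on S (cutoff2 X)"
proof -
  show "continuous_on S (cutoff X)" "continuous_on S (cutoff1 X)"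
    using cutoff_has_derivative cutoff1_has_derivative DERIV_isCont
    by (blast intro: continuous_at_imp_continuous_on)+
  have a: "continuous_on S (cut_arg X)"
    using cut_arg_has_derivative DERIV_isCont by (blast intro: continuous_at_imp_continuous_on)
  show "continuous_on S (cutoff2 X)"
    unfolding cutoff2_def[abs_def]
    by (intro continuous_intros continuous_on_osc a
        continuous_on_compose2[OF continuous_on_bumps(2)[of UNIV] a]
        continuous_on_compose2[OF continuous_on_bumps(3)[of UNIV] a]) auto
qed

lemma C_k_on_test: "C_k_on k UNIV (test_fun X)"
proof -
  have "C_k_on k UNIV (\<lambda>x. - 1 / 2 + cut_scale X * (conf_coord x + - conf_coord X))"
    by (intro C_k_on_add C_k_on_mult C_k_on_const C_k_on_conf_coord)
  then have "C_k_on k UNIV (cut_arg X)" by (simp add: cut_arg_def[abs_def])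
  then have "C_k_on k UNIV (cutoff X)"
    unfolding cutoff_def[abs_def] by (rule C_k_on_compose[OF C_k_on_bump])
  then show ?thesis
    unfolding test_fun_def[abs_def]
    by (intro C_k_on_mult C_k_on_compose[OF _ osc.C_k_on_coord] C_k_on_bump)
qed

text \<open>Within distance 1 of \<open>X\<close>, the value 1 + x^2 is at most 1 + (X + 1)^2 and at
  least a tenth of it. The factor 2 in \<open>cut_scale\<close> and the factor 3 between
  \<open>osc\<close> and 1 + x^2 turn the 10 into 60.\<close>

lemma cut_scale_bounds:
  assumes "\<bar>x - X\<bar> \<le> 1" "1 \<le> X"
  shows "osc x \<le> cut_scale X / 2" "cut_scale X / osc x \<le> 60" "2 \<le> cut_scale X / osc x" "cut_scale X / 60 \<le> osc x"
proof -
  have x: "0 \<le> x" "X - 1 \<le> x" "x \<le> X + 1" using assms by auto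
  have "osc x \<le> 1 + x\<^sup>2" by (rule osc_bounds)
  also have "x\<^sup>2 \<le> (X + 1)\<^sup>2" using x by (intro power_mono) auto
  finally show 1: "osc x \<le> cut_scale X / 2" by (simp add: cut_scale_def)
  then show "2 \<le> cut_scale X / osc x" using osc_bounds(3)[of x] by (simp add: le_divide_eq)
  have "(X - 1)\<^sup>2 \<le> x\<^sup>2" using x assms by (intro power_mono) auto
  moreover have "1 + (X + 1)\<^sup>2 \<le> 10 * (1 + (X - 1)\<^sup>2)"
  proof -
    \<comment> \<open>The difference of the two sides of the claim, with the square
      completed.\<close>
    have "0 \<le> (3 * X - 4)\<^sup>2 + 2 * X + 2" using assms by (intro add_nonneg_nonneg) auto
    then show ?thesis by (simp add: power2_eq_square algebra_simps)
  qed
  ultimately have "cut_scale X \<le> 60 * ((1 + x\<^sup>2) / 3)" by (simp add: cut_scale_def)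
  also have "\<dots> \<le> 60 * osc x" using osc_bounds(1)[of x] by simp
  finally show "cut_scale X / 60 \<le> osc x" by simp
  then show "cut_scale X / osc x \<le> 60" using osc_bounds(3)[of x] by (simp add: divide_le_eq)
qed

lemma cut_arg_mono: "x \<le> y \<Longrightarrow> cut_arg X x \<le> cut_arg X y"
  by (rule DERIV_nonneg_imp_nondecreasing)
    (use cut_arg_has_derivative cut_scale_pos osc_bounds(3) in \<open>blast intro: divide_nonneg_pos less_imp_le\<close>)+

text \<open>The slope of \<open>cut_arg\<close> lies between 2 and 60 here, so its differences with
  the linear functions of these slopes are monotone.\<close>

lemma cut_arg_increment:
  assumes "X - 1 \<le> x" "x \<le> y" "y \<le> X + 1" "1 \<le> X"
  shows "2 * (y - x) \<le> cut_arg X y - cut_arg X x" "cut_arg X y - cut_arg X x \<le> 60 * (y - x)"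
proof -
  have "cut_arg X x - 2 * x \<le> cut_arg X y - 2 * y"
  proof (rule DERIV_nonneg_imp_nondecreasing[OF assms(2)])
    fix s assume "x \<le> s" "s \<le> y"
    then have "2 \<le> cut_scale X / osc s" using assms by (intro cut_scale_bounds) auto
    then show "\<exists>d. ((\<lambda>s. cut_arg X s - 2 * s) has_real_derivative d) (at s) \<and> 0 \<le> d"
      by (intro exI[of _ "cut_scale X / osc s - 2"]) (auto intro!: derivative_eq_intros cut_arg_has_derivative)
  qed
  then show "2 * (y - x) \<le> cut_arg X y - cut_arg X x" by simp
  have "60 * x - cut_arg X x \<le> 60 * y - cut_arg X y"
  proof (rule DERIV_nonneg_imp_nondecreasing[OF assms(2)])
    fix s assume "x \<le> s" "s \<le> y"
    then have "cut_scale X / osc s \<le> 60" using assms by (intro cut_scale_bounds) auto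
    then show "\<exists>d. ((\<lambda>s. 60 * s - cut_arg X s) has_real_derivative d) (at s) \<and> 0 \<le> d"
      by (intro exI[of _ "60 - cut_scale X / osc s"]) (auto intro!: derivative_eq_intros cut_arg_has_derivative)
  qed
  then show "cut_arg X y - cut_arg X x \<le> 60 * (y - x)" by simp
qed

text \<open>A slope of at least 2 carries the argument from - 1 / 2 to at least 3 / 2 at X + 1 and
  to at most - 5 / 2 at X - 1. Monotonicity keeps it outside the support of \<open>bump\<close>
  further out.\<close>

lemma cutoff_eq_0:
  assumes "1 < \<bar>x - X\<bar>" "1 \<le> X"
  shows "cutoff X x = 0" "cutoff1 X x = 0" "cutoff2 X x = 0"
proof -
  have "1 \<le> \<bar>cut_arg X x\<bar>"
  proof (cases "x > X")
    case True
    then have "cut_arg X (X + 1) \<le> cut_arg X x" using assms by (intro cut_arg_mono) auto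
    moreover have "2 \<le> cut_arg X (X + 1) - cut_arg X X" using cut_arg_increment(1)[of X X "X + 1"] assms by simp
    ultimately show ?thesis by (simp add: cut_arg_def)
  next
    case False
    then have "cut_arg X x \<le> cut_arg X (X - 1)" using assms by (intro cut_arg_mono) auto
    moreover have "2 \<le> cut_arg X X - cut_arg X (X - 1)" using cut_arg_increment(1)[of X "X - 1" X] assms by simp
    ultimately show ?thesis by (simp add: cut_arg_def)
  qed
  then show "cutoff X x = 0" "cutoff1 X x = 0" "cutoff2 X x = 0"
    by (simp_all add: cutoff_def cutoff1_def cutoff2_def bump_eq_0)
qed

section \<open>Support, Laplacian and Hessian of the test functions\<close>

abbreviation box_at :: "real \<Rightarrow> (real^2) set" where
  "box_at X \<equiv> rect (X - 1) (X + 1) (- 1) 1"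

lemma outside_box:
  assumes "p \<notin> box_at X"
  shows "1 < \<bar>p $ 1 - X\<bar> \<or> 1 < \<bar>p $ 2\<bar>"
  using assms by (auto simp: mem_rect)

lemma test_fun_eq_0:
  assumes "1 \<le> X" "p \<notin> box_at X"
  shows "test_fun X p = 0"
  using outside_box[OF assms(2)] cutoff_eq_0[OF _ assms(1), of "p $ 1"] bump_eq_0[of "p $ 2"]
  by (auto simp: test_fun_def)

lemma test_in_test_functions:
  assumes "1 \<le> X"
  shows "test_fun X \<in> test_functions (warped_plane osc)"
proof -
  have "closure {p. test_fun X p \<noteq> 0} \<subseteq> box_at X"
    using test_fun_eq_0[OF assms] by (intro closure_minimal compact_imp_closed compact_rect) auto
  then have "compact (closure {p. test_fun X p \<noteq> 0})"
    using compact_rect closed_closure by (metis compact_Int_closed inf.absorb_iff2)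
  then show ?thesis
    using C_k_on_test by (simp add: test_functions_def smooth_on_def)
qed

text \<open>The first-order part of the Laplacian cancels the \<open>osc1\<close> term of
  \<open>cutoff2\<close>. This is the conformal covariance of the Laplacian in dimension
  two.\<close>

lemma laplacian_test:
  "laplacian (warped_plane osc) (test_fun X) p = - (bump2 (cut_arg X (p $ 1)) * (cut_scale X / osc (p $ 1))\<^sup>2 * bump (p $ 2)
     + cutoff X (p $ 1) * bump2 (p $ 2) / (osc (p $ 1))\<^sup>2)"
proof -
  have "cutoff2 X s + osc1 s / osc s * cutoff1 X s = bump2 (cut_arg X s) * (cut_scale X / osc s)\<^sup>2" for s
    by (simp add: cutoff1_def cutoff2_def algebra_simps)
  then show ?thesis
    unfolding test_fun_def[abs_def]
    by (simp add: osc.laplacian_product[OF cutoff_has_derivative cutoff1_has_derivative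
          bump_has_derivative bump1_has_derivative])
qed

lemma hess_test:
  fixes p :: "real^2"
  defines "s \<equiv> p $ 1" and "t \<equiv> p $ 2"
  shows "(hess_norm (warped_plane osc) (test_fun X) p)\<^sup>2 = (cutoff2 X s * bump t)\<^sup>2
    + 2 * ((cutoff1 X s * bump1 t - osc1 s / osc s * (cutoff X s * bump1 t)) / osc s)\<^sup>2
    + ((cutoff X s * bump2 t + osc s * osc1 s * (cutoff1 X s * bump t)) / (osc s)\<^sup>2)\<^sup>2"
  unfolding test_fun_def[abs_def] s_def t_def
  by (rule osc.hess_norm_product_square[OF cutoff_has_derivative cutoff1_has_derivative
          bump_has_derivative bump1_has_derivative])

section \<open>Upper bounds for the function and its Laplacian\<close>

lemma continuous_on_compose_coord:
  assumes "continuous_on UNIV g"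
  shows "continuous_on S (\<lambda>p::real^2. g (p $ i))"
  by (rule continuous_on_compose2[OF assms]) (auto intro: continuous_intros)

lemma continuous_test_quantities:
  "continuous_on UNIV (test_fun X)"
  "continuous_on UNIV (laplacian (warped_plane osc) (test_fun X))"
  "continuous_on UNIV (\<lambda>p. (hess_norm (warped_plane osc) (test_fun X) p)\<^sup>2)"
proof -
  have a: "continuous_on UNIV (\<lambda>x. bump2 (cut_arg X x))"
    using continuous_on_compose2[OF continuous_on_bumps(3)[of UNIV], of UNIV "cut_arg X"]
      cut_arg_has_derivative DERIV_isCont by (blast intro: continuous_at_imp_continuous_on)
  note c = continuous_on_cutoff[of UNIV, THEN continuous_on_compose_coord]
    continuous_on_bumps[of UNIV, THEN continuous_on_compose_coord]
    continuous_on_osc[of UNIV, THEN continuous_on_compose_coord]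
    continuous_on_compose_coord[OF a]
  show "continuous_on UNIV (test_fun X)"
    unfolding test_fun_def[abs_def] by (intro continuous_intros c)
  show "continuous_on UNIV (laplacian (warped_plane osc) (test_fun X))"
    unfolding laplacian_test[abs_def] by (intro continuous_intros c) auto
  show "continuous_on UNIV (\<lambda>p. (hess_norm (warped_plane osc) (test_fun X) p)\<^sup>2)"
    unfolding hess_test by (intro continuous_intros c) auto
qed

text \<open>The box has Euclidean area 4 and the density there is at most half of
  \<open>cut_scale X\<close>, so its volume is at most twice \<open>cut_scale X\<close>.\<close>

lemma L2_norm_le_of_bounded:
  assumes "continuous_on UNIV \<phi>" "1 \<le> X" "\<And>p. p \<in> box_at X \<Longrightarrow> \<bar>\<phi> p\<bar> \<le> c"
    "\<And>p. p \<notin> box_at X \<Longrightarrow> \<phi> p = 0"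
  shows "L2_norm (warped_plane osc) \<phi> \<le> sqrt (2 * cut_scale X) * c"
proof -
  \<comment> \<open>A point of the box shows that the bound \<open>c\<close> is not
    negative.\<close>
  have "vector [X, 0] \<in> box_at X" by (simp add: mem_rect)
  from assms(3)[OF this] have c: "0 \<le> c" by linarith
  have "(\<lambda>x. (\<phi> x)\<^sup>2) \<in> borel_measurable borel"
    by (intro borel_measurable_continuous_onI continuous_intros assms(1))
  then have "L2_norm (warped_plane osc) \<phi> = sqrt (\<integral>p. osc (p $ 1) * (\<phi> p)\<^sup>2 \<partial>lborel)"
    by (rule osc.L2_norm_warped_plane)
  also have "\<dots> \<le> sqrt ((X + 1 - (X - 1)) * (1 - - 1) * (cut_scale X / 2 * c\<^sup>2))"
  proof (intro real_sqrt_le_mono integral_le_rect)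
    fix p assume p: "p \<in> box_at X"
    then have "osc (p $ 1) \<le> cut_scale X / 2" using assms(2) by (intro cut_scale_bounds) (auto simp: mem_rect)
    moreover have "(\<phi> p)\<^sup>2 \<le> c\<^sup>2" using assms(3)[OF p] c by (simp add: abs_le_square_iff[symmetric])
    ultimately show "osc (p $ 1) * (\<phi> p)\<^sup>2 \<le> cut_scale X / 2 * c\<^sup>2"
      using cut_scale_pos[of X] by (intro mult_mono) auto
  qed (use assms(4) cut_scale_pos[of X] in \<open>auto simp: less_imp_le\<close>)
  also have "\<dots> = sqrt (2 * cut_scale X) * c" using c by (simp add: real_sqrt_mult)
  finally show ?thesis .
qed

text \<open>The constant is 60^2 + 9: the first summand bounds the squared slope of
  \<open>cut_arg\<close>, the second 1 / f^2, as f is at least 1 / 3.\<close>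

lemma L2_norm_test_upper:
  assumes "1 \<le> B" "\<And>t. \<bar>bump t\<bar> \<le> B" "\<And>t. \<bar>bump2 t\<bar> \<le> B" "1 \<le> X"
  shows "L2_norm (warped_plane osc) (test_fun X) \<le> sqrt (2 * cut_scale X) * B\<^sup>2"
    and "L2_norm (warped_plane osc) (laplacian (warped_plane osc) (test_fun X)) \<le> sqrt (2 * cut_scale X) * (3609 * B\<^sup>2)"
proof -
  show "L2_norm (warped_plane osc) (test_fun X) \<le> sqrt (2 * cut_scale X) * B\<^sup>2"
  proof (rule L2_norm_le_of_bounded[OF continuous_test_quantities(1) assms(4) _ test_fun_eq_0[OF assms(4)]])
    show "\<bar>test_fun X p\<bar> \<le> B\<^sup>2" for p
      unfolding test_fun_def cutoff_def abs_mult power2_eq_square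
      using assms by (intro mult_mono) auto
  qed
  show "L2_norm (warped_plane osc) (laplacian (warped_plane osc) (test_fun X)) \<le> sqrt (2 * cut_scale X) * (3609 * B\<^sup>2)"
  proof (rule L2_norm_le_of_bounded[OF continuous_test_quantities(2) assms(4)])
    fix p assume "p \<in> box_at X"
    then have sc: "cut_scale X / osc (p $ 1) \<le> 60" "2 \<le> cut_scale X / osc (p $ 1)"
      using assms(4) by (intro cut_scale_bounds; auto simp: mem_rect)+
    let ?a = "bump2 (cut_arg X (p $ 1)) * (cut_scale X / osc (p $ 1))\<^sup>2 * bump (p $ 2)"
    let ?b = "cutoff X (p $ 1) * bump2 (p $ 2) / (osc (p $ 1))\<^sup>2"
    have "\<bar>(cut_scale X / osc (p $ 1))\<^sup>2\<bar> \<le> 3600"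
      using power_mono[OF sc(1), of 2] sc(2) by simp
    then have "\<bar>?a\<bar> \<le> B * 3600 * B"
      unfolding abs_mult using assms(1-3) by (intro mult_mono) auto
    moreover have "\<bar>?b\<bar> \<le> B * B * 9"
    proof -
      have "1 / 3 \<le> osc (p $ 1)"
        by (rule order_trans[OF _ osc_bounds(1)]) simp
      then have "1 / osc (p $ 1) \<le> 3" using osc_bounds(3)[of "p $ 1"] by (simp add: field_simps)
      then have "(1 / osc (p $ 1))\<^sup>2 \<le> 3\<^sup>2"
        using osc_bounds(3)[of "p $ 1"] by (intro power_mono) auto
      then have "\<bar>(1 / osc (p $ 1))\<^sup>2\<bar> \<le> 9" by simp
      then have "\<bar>cutoff X (p $ 1) * bump2 (p $ 2) * (1 / osc (p $ 1))\<^sup>2\<bar> \<le> B * B * 9"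
        unfolding abs_mult cutoff_def using assms by (intro mult_mono) auto
      then show ?thesis by (simp add: power_divide)
    qed
    ultimately show "\<bar>laplacian (warped_plane osc) (test_fun X) p\<bar> \<le> 3609 * B\<^sup>2"
      unfolding laplacian_test abs_minus_cancel power2_eq_square[of B]
      by (intro order_trans[OF abs_triangle_ineq]) linarith
  next
    fix p assume "p \<notin> box_at X"
    from outside_box[OF this] show "laplacian (warped_plane osc) (test_fun X) p = 0"
    proof
      assume "1 < \<bar>p $ 1 - X\<bar>"
      note z = cutoff_eq_0[OF this assms(4)]
      \<comment> \<open>\<open>cutoff_eq_0\<close> concerns the cutoff and its derivatives, hence
        the product formula before the cancellation.\<close>
      show ?thesis
        unfolding test_fun_def[abs_def] osc.laplacian_product[OF cutoff_has_derivative cutoff1_has_derivative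
          bump_has_derivative bump1_has_derivative] by (simp add: z)
    qed (simp add: laplacian_test bump_eq_0)
  qed
qed

section \<open>Lower bound for the Hessian\<close>

lemma hess_test_eq_0:
  assumes "1 \<le> X" "p \<notin> box_at X"
  shows "(hess_norm (warped_plane osc) (test_fun X) p)\<^sup>2 = 0"
  using outside_box[OF assms(2)] cutoff_eq_0[OF _ assms(1), of "p $ 1"] bump_eq_0[of "p $ 2"]
  unfolding hess_test by auto

text \<open>At X^2 in 2 \<pi> \<nat> the cosine is 1. On a strip of width 1 / (240 X) it stays above
  1 / 2, while the argument of \<open>bump1\<close> stays on the rising flank, so that the
  \<open>osc1\<close> term is of size X.\<close>

lemma cutoff2_lower:
  assumes B: "\<And>t. \<bar>bump1 t\<bar> \<le> B" "\<And>t. \<bar>bump2 t\<bar> \<le> B"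
    and m: "0 < m" "\<And>t. - 1 / 2 \<le> t \<Longrightarrow> t \<le> - 1 / 4 \<Longrightarrow> m \<le> bump1 t"
    and X: "1 \<le> X" "X\<^sup>2 = 2 * real n * pi" "10980 * B \<le> m * X"
    and x: "X \<le> x" "x \<le> X + 1 / (240 * X)"
  shows "m * X / 3 \<le> cutoff2 X x"
proof -
  have B0: "0 \<le> B" using B(1)[of 0] by linarith
  have x1: "x - X \<le> 1 / (240 * X)" "1 / (240 * X) \<le> 1 / 240" using x X by (auto simp: field_simps)
  then have dx: "0 \<le> x - X" "x - X \<le> 1 / 240" using x by auto
  \<comment> \<open>The slope is at most 60 and the distance at most 1 / 240, so the argument moves
    by at most 1 / 4.\<close>
  have arg: "- 1 / 2 \<le> cut_arg X x" "cut_arg X x \<le> - 1 / 4"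
    using cut_arg_increment[of X X x] X(1) dx by (auto simp: cut_arg_def)
  note sc = cut_scale_bounds(2,3)[of x X]
  have sc: "cut_scale X / osc x \<le> 60" "2 \<le> cut_scale X / osc x" using sc X dx by auto
  have cos: "1 / 2 \<le> cos (x\<^sup>2)"
  proof -
    \<comment> \<open>The factor 1 / X in the width keeps x^2 - X^2 below 1, hence below pi /
      3.\<close>
    have "X * (x - X) \<le> 1 / 240" using x1(1) X(1) by (simp add: field_simps)
    moreover have "(x - X)\<^sup>2 \<le> 1 / 240"
      using mult_mono[OF dx(2) dx(2)] dx by (simp add: power2_eq_square)
    moreover have "x\<^sup>2 - X\<^sup>2 = 2 * (X * (x - X)) + (x - X)\<^sup>2"
      by (simp add: power2_eq_square algebra_simps)
    ultimately have "x\<^sup>2 - X\<^sup>2 \<le> 1" by linarith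
    moreover have "0 \<le> x\<^sup>2 - X\<^sup>2" using power_mono[OF x(1), of 2] X(1) by simp
    ultimately have "cos (pi / 3) \<le> cos (x\<^sup>2 - X\<^sup>2)"
      using pi_gt3 by (intro cos_monotone_0_pi_le) auto
    also have "cos (x\<^sup>2 - X\<^sup>2) = cos (x\<^sup>2)"
      by (simp add: X(2) cos_diff cos_2npi sin_2npi)
    finally show ?thesis by (simp add: cos_60)
  qed
  let ?r = "cut_scale X / osc x" and ?d = "2 + sin (x\<^sup>2)"
  \<comment> \<open>The logarithmic derivative splits into a part bounded by 1 and an oscillating
    part of size X.\<close>
  have ratio: "osc1 x / osc x = 2 * x / (1 + x\<^sup>2) - 2 * x * cos (x\<^sup>2) / ?d"
  proof -
    have "1 + x\<^sup>2 \<noteq> 0" by (metis add_pos_nonneg less_irrefl zero_le_power2 zero_less_one)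
    then show ?thesis
      unfolding osc1_def osc_def using osc_denominator(3)[of x]
      by (simp add: divide_simps) (simp add: power2_eq_square algebra_simps)
  qed
  have "X / 3 \<le> 2 * x * cos (x\<^sup>2) / ?d"
  proof -
    have "X * ?d \<le> x * 3" using x X osc_denominator[of x] by (intro mult_mono) auto
    also have "x * (1 / 2) \<le> x * cos (x\<^sup>2)" using cos x X by (intro mult_left_mono) auto
    then have "x * 3 \<le> 3 * (2 * x * cos (x\<^sup>2))" by simp
    finally show ?thesis using osc_denominator(1)[of x] by (simp add: field_simps)
  qed
  then have main: "m * 2 * (X / 3) \<le> bump1 (cut_arg X x) * ?r * (2 * x * cos (x\<^sup>2) / ?d)"
  proof (intro mult_mono)
    show "0 \<le> bump1 (cut_arg X x) * ?r"
      using m(1) m(2)[OF arg] sc by (intro mult_nonneg_nonneg) linarith+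
  qed (use m(1) m(2)[OF arg] sc X in auto)
  have "bump1 (cut_arg X x) * ?r * (2 * x / (1 + x\<^sup>2)) \<le> B * 60 * 1"
  proof (intro mult_mono)
    show "bump1 (cut_arg X x) \<le> B" using B(1)[of "cut_arg X x"] by linarith
    show "2 * x / (1 + x\<^sup>2) \<le> 1"
      using abs_le_1_plus_square(2)[of x] x X by (simp add: divide_le_eq add_pos_nonneg)
  qed (use sc B0 x X in \<open>auto intro!: divide_nonneg_nonneg mult_nonneg_nonneg\<close>)
  moreover have "\<bar>?r\<^sup>2\<bar> \<le> 3600"
    using power_mono[OF sc(1), of 2] sc(2) by simp
  then have "\<bar>bump2 (cut_arg X x) * ?r\<^sup>2\<bar> \<le> B * 3600"
    unfolding abs_mult using B B0 by (intro mult_mono) auto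
  moreover have "cutoff2 X x = bump2 (cut_arg X x) * ?r\<^sup>2 - bump1 (cut_arg X x) * ?r * (2 * x / (1 + x\<^sup>2))
      + bump1 (cut_arg X x) * ?r * (2 * x * cos (x\<^sup>2) / ?d)"
    unfolding cutoff2_def ratio by (simp add: algebra_simps)
  \<comment> \<open>The main term is at least 2 m X / 3, and the other two are at most (3600 + 60) B
    = 10980 B / 3 in absolute value or from the unfavourable side, hence at most m X / 3
    together.\<close>
  ultimately show ?thesis using main X(3) by linarith
qed

text \<open>Integrating over a strip of width 1 / (240 X) and height 1 leaves one power of X; 259200
  is 2 * 240 * 60 * 9. The factor \<open>2 * cut_scale X\<close> is split off to match the upper
  bounds.\<close>

lemma L2_norm_hess_test_lower:
  assumes B: "\<And>t. \<bar>bump1 t\<bar> \<le> B" "\<And>t. \<bar>bump2 t\<bar> \<le> B"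
    and m: "0 < m" "\<And>t. - 1 / 2 \<le> t \<Longrightarrow> t \<le> - 1 / 4 \<Longrightarrow> m \<le> bump1 t"
      "\<And>t. - 1 / 2 \<le> t \<Longrightarrow> t \<le> 1 / 2 \<Longrightarrow> m \<le> bump t"
    and X: "1 \<le> X" "X\<^sup>2 = 2 * real n * pi" "10980 * B \<le> m * X"
  shows "sqrt (2 * cut_scale X) * sqrt (m ^ 4 / 259200 * X) \<le> L2_norm (warped_plane osc) (hess_norm (warped_plane osc) (test_fun X))"
proof -
  let ?H = "\<lambda>p. (hess_norm (warped_plane osc) (test_fun X) p)\<^sup>2"
  note cont = continuous_test_quantities(3)[of X]
  have int: "integrable lborel (\<lambda>p. osc (p $ 1) * ?H p)"
    by (rule integrable_supported_rect[where a = "X - 1" and b = "X + 1" and c = "- 1" and d = 1])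
      (use hess_test_eq_0[OF X(1)] in \<open>auto intro!: continuous_intros cont
        continuous_on_compose_coord continuous_on_osc\<close>)
  have L: "L2_norm (warped_plane osc) (hess_norm (warped_plane osc) (test_fun X)) = sqrt (\<integral>p. osc (p $ 1) * ?H p \<partial>lborel)"
    by (intro osc.L2_norm_warped_plane borel_measurable_continuous_onI cont)
  have low: "(X + 1 / (240 * X) - X) * (1 / 2 - - 1 / 2) * (cut_scale X / 60 * (m * X / 3 * m)\<^sup>2)
      \<le> (\<integral>p. osc (p $ 1) * ?H p \<partial>lborel)"
  proof (rule integral_ge_rect[OF _ _ int])
    show "0 \<le> osc (p $ 1) * ?H p" for p using osc_bounds(3)[of "p $ 1"] by simp
    fix p :: "real^2" assume "p \<in> rect X (X + 1 / (240 * X)) (- 1 / 2) (1 / 2)"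
    then have p: "X \<le> p $ 1" "p $ 1 \<le> X + 1 / (240 * X)" "- 1 / 2 \<le> p $ 2" "p $ 2 \<le> 1 / 2"
      by (auto simp: mem_rect)
    have "1 / (240 * X) \<le> 1" using X by (simp add: field_simps)
    then have "\<bar>p $ 1 - X\<bar> \<le> 1" using p by linarith
    then have "cut_scale X / 60 \<le> osc (p $ 1)" using X by (intro cut_scale_bounds)
    moreover have "(m * X / 3 * m)\<^sup>2 \<le> ?H p"
    proof -
      have "m * X / 3 * m \<le> cutoff2 X (p $ 1) * bump (p $ 2)"
      proof (intro mult_mono)
        show *: "m * X / 3 \<le> cutoff2 X (p $ 1)" by (rule cutoff2_lower[OF B m(1,2) X p(1,2)])
        show "m \<le> bump (p $ 2)" by (rule m(3)[OF p(3,4)])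
        have "0 \<le> m * X / 3" using m(1) X(1) by simp
        then show "0 \<le> cutoff2 X (p $ 1)" using * by linarith
      qed (use m(1) in simp)
      then have "(m * X / 3 * m)\<^sup>2 \<le> (cutoff2 X (p $ 1) * bump (p $ 2))\<^sup>2"
        using m(1) X by (intro power_mono) auto
      \<comment> \<open>The other two summands of the squared Hessian norm are not negative.\<close>
      then show ?thesis unfolding hess_test by (smt (verit) zero_le_power2)
    qed
    ultimately show "cut_scale X / 60 * (m * X / 3 * m)\<^sup>2 \<le> osc (p $ 1) * ?H p"
      using osc_bounds(3)[of "p $ 1"] by (intro mult_mono) auto
  qed (use X in auto)
  have "(X + 1 / (240 * X) - X) * (1 / 2 - - 1 / 2) * (cut_scale X / 60 * (m * X / 3 * m)\<^sup>2)
      = 2 * cut_scale X * (m ^ 4 / 259200 * X)"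
    using X by (simp add: field_simps power2_eq_square eval_nat_numeral)
  then show ?thesis
    using low unfolding L real_sqrt_mult[symmetric] by (intro real_sqrt_le_mono) simp
qed

lemma not_CZ2_osc: "\<not> CZ2 (warped_plane osc)"
proof
  let ?N = "warped_plane osc"
  assume "CZ2 ?N"
  then obtain C1 C2 where C: "0 \<le> C1" "0 < C2"
    and CZ: "\<And>u. u \<in> test_functions ?N \<Longrightarrow>
      L2_norm ?N (hess_norm ?N u) \<le> C1 * L2_norm ?N u + C2 * L2_norm ?N (laplacian ?N u)"
    unfolding CZ2_def by blast
  obtain B where B: "1 \<le> B" "\<And>t. \<bar>bump t\<bar> \<le> B" "\<And>t. \<bar>bump1 t\<bar> \<le> B" "\<And>t. \<bar>bump2 t\<bar> \<le> B"
    using bumps_bounded by blast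
  \<comment> \<open>The minima over compact intervals inside the regions of positivity give a lower
    bound \<open>m\<close> independent of \<open>X\<close>.\<close>
  obtain t1 where t1: "t1 \<in> {- 1 / 2 .. - 1 / 4}" "\<And>t. t \<in> {- 1 / 2 .. - 1 / 4} \<Longrightarrow> bump1 t1 \<le> bump1 t"
    using continuous_attains_inf[of "{- 1 / 2 .. - 1 / 4}" bump1] continuous_on_bumps(2) by auto
  obtain t0 where t0: "t0 \<in> {- 1 / 2 .. 1 / 2}" "\<And>t. t \<in> {- 1 / 2 .. 1 / 2} \<Longrightarrow> bump t0 \<le> bump t"
    using continuous_attains_inf[of "{- 1 / 2 .. 1 / 2}" bump] continuous_on_bumps(1) by auto
  define m where "m = min (bump1 t1) (bump t0)"
  have m: "0 < m" "\<And>t. - 1 / 2 \<le> t \<Longrightarrow> t \<le> - 1 / 4 \<Longrightarrow> m \<le> bump1 t"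
    "\<And>t. - 1 / 2 \<le> t \<Longrightarrow> t \<le> 1 / 2 \<Longrightarrow> m \<le> bump t"
    using t0 t1 bump1_pos[of t1] bump_pos[of t0] by (auto simp: m_def min_le_iff_disj)
  \<comment> \<open>The right-hand side of the inequality divided by the common factor
    \<open>sqrt (2 * cut_scale X)\<close>; it does not depend on \<open>X\<close>.\<close>
  define D where "D = C1 * B\<^sup>2 + C2 * (3609 * B\<^sup>2)"
  \<comment> \<open>The second entry is the threshold of \<open>cutoff2_lower\<close>; the third
    pushes the squared lower bound above the square of \<open>D\<close>.\<close>
  define Y where "Y = max 1 (max (10980 * B / m) (259200 * (D\<^sup>2 + 1) / m ^ 4))"
  obtain n :: nat where n: "Y\<^sup>2 < real n" using reals_Archimedean2 by blast
  define X where "X = sqrt (2 * real n * pi)"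
  have X2: "X\<^sup>2 = 2 * real n * pi" by (simp add: X_def)
  have "real n * 1 \<le> real n * (2 * pi)" using pi_gt3 by (intro mult_left_mono) auto
  then have "Y\<^sup>2 \<le> X\<^sup>2" using n by (simp add: X2 algebra_simps)
  then have YX: "Y \<le> X" by (rule power2_le_imp_le) (simp add: X_def)
  then have X: "1 \<le> X" "10980 * B / m \<le> X" "259200 * (D\<^sup>2 + 1) / m ^ 4 \<le> X" by (auto simp: Y_def)
  have X3: "10980 * B \<le> m * X" using X(2) m(1) by (simp add: divide_le_eq mult.commute)
  have sp: "0 < sqrt (2 * cut_scale X)" using cut_scale_pos[of X] by simp
  have "sqrt (2 * cut_scale X) * sqrt (m ^ 4 / 259200 * X) \<le> L2_norm ?N (hess_norm ?N (test_fun X))"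
    by (rule L2_norm_hess_test_lower[OF B(3,4) m X(1) X2 X3])
  also have "\<dots> \<le> C1 * L2_norm ?N (test_fun X) + C2 * L2_norm ?N (laplacian ?N (test_fun X))"
    by (rule CZ[OF test_in_test_functions[OF X(1)]])
  also have "\<dots> \<le> C1 * (sqrt (2 * cut_scale X) * B\<^sup>2) + C2 * (sqrt (2 * cut_scale X) * (3609 * B\<^sup>2))"
    using C by (intro add_mono mult_left_mono L2_norm_test_upper B X(1)) auto
  also have "\<dots> = sqrt (2 * cut_scale X) * D" by (simp add: D_def algebra_simps)
  finally have "sqrt (m ^ 4 / 259200 * X) \<le> D" using sp by simp
  then have "m ^ 4 / 259200 * X \<le> D\<^sup>2" by (rule sqrt_le_D)
  moreover have "D\<^sup>2 + 1 \<le> m ^ 4 / 259200 * X"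
    using X(3) m(1) by (simp add: field_simps)
  ultimately show False by simp
qed

theorem theorem4p2:
  shows "\<exists>N :: (real^2, 2) riem_mfd.
           riemannian_manifold N \<and>
           geodesically_complete N \<and>
           \<not> bounded (gaussian_curvature N ` topspace (mtop N)) \<and>
           \<not> CZ2 N"
  using osc.riemannian_manifold_warped_plane geodesically_complete_osc
    unbounded_curvature_osc not_CZ2_osc
  by (intro exI[of _ "warped_plane osc"]) simp

end
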